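(* Let $w$ be a graphon satisfying (A1) with constant $K$. Then for every $N\in\mathbb{N}$, $$\|\mathbb{L}_N-\mathbb{L}\|_{op}\le \frac{4K}{N}.$$ Moreover, let $\tau\in[0,1)$ and $\rho_N=N^{-\tau}$, and let $G^{(N)}\sim\rho_N w$. For every $\varepsilon\in(0,1)$ and every $N\ge N_1(w,\tau,\varepsilon)$, $$\mathbb{P}\Big(\|\rho_N^{-1}\widehat{\mathbb{L}}_N-\mathbb{L}\|_{op}\le 4\sqrt{\tfrac{\log(4N/\varepsilon)}{\rho_N N}}+\tfrac{4K}{N}\Big)\ge 1-\varepsilon,$$ and for every $\gamma>1$ and every $N\ge N_1'(w,\tau,\gamma)$ the same inequality holds with $\varepsilon$ replaced by $\varepsilon_\gamma(N)$ (both in the bound and in the probability).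
   Context: A graphon is a measurable symmetric function $w:[0,1]^2\to[0,1]$, with degree $d(x)=\int_0^1 w(x,y)\,dy$ and $d_{\mathrm{MAX}}=\max_x d(x)$. Assumption (A1): there is $K>0$ with $|w(x,y)-w(x',y')|\le K(|x-x'|+|y-y'|)$. For a graphon $u$, its graphon-Laplacian is the operator on $L^2([0,1])$ given by $f\mapsto \int_0^1 u(x,y)(f(x)-f(y))\,dy$; $\mathbb{L}$ is the one for $w$. $\|\cdot\|_{op}$ is the operator norm on $L^2([0,1])$. Random graph model $G^{(N)}\sim\rho_N w$: vertices $v_i=i/N$, $i\in[N]$; for each $i<j$ independently, the edge $\{i,j\}$ is present with probability $\rho_N w(i/N,j/N)$; $\widehat P^{(N)}$ is the (symmetric, zero-diagonal) adjacency matrix and $P^{(N)}_{ij}=w(i/N,j/N)$. With $\mathcal{I}_1=[0,1/N]$, $\mathcal{I}_i=((i-1)/N,i/N]$ for $i\ge2$, set $w_N(x,y)=\sum_{i,j}P^{(N)}_{ij}\mathbf{1}_{\mathcal{I}_i}(x)\mathbf{1}_{\mathcal{I}_j}(y)$ and $\widehat w_N(x,y)=\sum_{i,j}\widehat P^{(N)}_{ij}\mathbf{1}_{\mathcal{I}_i}(x)\mathbf{1}_{\mathcal{I}_j}(y)$; $\mathbb{L}_N,\widehat{\mathbb{L}}_N$ are the graphon-Laplacians of $w_N,\widehat w_N$. Let $\varepsilon_\gamma(N)=\exp(-(\log N)^\gamma)$. $N_1(w,\tau,\varepsilon)=\min\{n: N\ge n\Rightarrow d_{\mathrm{MAX}}\ge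 \frac{4\log(4N/\varepsilon)}{9\rho_N N}+\frac{2K}{N}\}$ and $N_1'(w,\tau,\gamma)$ is defined the same way with $\varepsilon$ replaced by $\varepsilon_\gamma(N)$. *)

theory Defs
  imports "HOL-Analysis.Analysis" "HOL-Probability.Probability"
begin

text \<open>A graphon is represented by a real function of two real variables; only its values
on the unit square matter.\<close>

definition graphon :: "(real \<Rightarrow> real \<Rightarrow> real) \<Rightarrow> bool" where
  "graphon w \<longleftrightarrow>
     (\<lambda>p. w (fst p) (snd p)) \<in> borel_measurable (restrict_space lborel ({0..1} \<times> {0..1}))
   \<and> (\<forall>x\<in>{0..1}. \<forall>y\<in>{0..1}. w x y = w y x \<and> 0 \<le> w x y \<and> w x y \<le> 1)"

definition lipschitz_A1 :: "(real \<Rightarrow> real \<Rightarrow> real) \<Rightarrow> real \<Rightarrow> bool" where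
  "lipschitz_A1 w K \<longleftrightarrow>
     (\<forall>x\<in>{0..1}. \<forall>y\<in>{0..1}. \<forall>x'\<in>{0..1}. \<forall>y'\<in>{0..1}.
        \<bar>w x y - w x' y'\<bar> \<le> K * (\<bar>x - x'\<bar> + \<bar>y - y'\<bar>))"

definition degree :: "(real \<Rightarrow> real \<Rightarrow> real) \<Rightarrow> real \<Rightarrow> real" where
  "degree w x = (LINT y:{0..1}|lborel. w x y)"

definition d_max :: "(real \<Rightarrow> real \<Rightarrow> real) \<Rightarrow> real" where
  "d_max w = (SUP x\<in>{0..1}. degree w x)"

definition L2_space :: "(real \<Rightarrow> real) set" where
  "L2_space = {f. f \<in> borel_measurable lborel \<and> set_integrable lborel {0..1} (\<lambda>x. (f x)^2)}"

definition L2_norm :: "(real \<Rightarrow> real) \<Rightarrow> real" where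
  "L2_norm f = sqrt (LINT x:{0..1}|lborel. (f x)^2)"

text \<open>Operator norm on L2([0,1]), valued in the extended reals (so it is \<open>\<infinity>\<close> for
unbounded operators).\<close>

definition op_norm :: "((real \<Rightarrow> real) \<Rightarrow> (real \<Rightarrow> real)) \<Rightarrow> ereal" where
  "op_norm T = (SUP f\<in>{f\<in>L2_space. L2_norm f \<le> 1}. ereal (L2_norm (T f)))"

definition graphon_laplacian ::
  "(real \<Rightarrow> real \<Rightarrow> real) \<Rightarrow> (real \<Rightarrow> real) \<Rightarrow> real \<Rightarrow> real" where
  "graphon_laplacian u f x = (LINT y:{0..1}|lborel. u x y * (f x - f y))"

definition cell :: "nat \<Rightarrow> nat \<Rightarrow> real set" where
  "cell N i = (if i = 1 then {0..1 / real N} else {(real i - 1) / real N <.. real i / real N})"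

definition step_graphon :: "nat \<Rightarrow> (nat \<Rightarrow> nat \<Rightarrow> real) \<Rightarrow> real \<Rightarrow> real \<Rightarrow> real" where
  "step_graphon N M x y =
     (\<Sum>i\<in>{1..N}. \<Sum>j\<in>{1..N}. M i j * indicator (cell N i) x * indicator (cell N j) y)"

definition sample_matrix :: "(real \<Rightarrow> real \<Rightarrow> real) \<Rightarrow> nat \<Rightarrow> nat \<Rightarrow> nat \<Rightarrow> real" where
  "sample_matrix w N i j = w (real i / real N) (real j / real N)"

definition edge_slots :: "nat \<Rightarrow> (nat \<times> nat) set" where
  "edge_slots N = {(i, j). 1 \<le> i \<and> i < j \<and> j \<le> N}"

definition random_graph :: "(real \<Rightarrow> real \<Rightarrow> real) \<Rightarrow> real \<Rightarrow> nat \<Rightarrow> (nat \<times> nat \<Rightarrow> bool) pmf" where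
  "random_graph w \<rho> N =
     Pi_pmf (edge_slots N) False
       (\<lambda>(i, j). bernoulli_pmf (\<rho> * w (real i / real N) (real j / real N)))"

definition adj_matrix :: "(nat \<times> nat \<Rightarrow> bool) \<Rightarrow> nat \<Rightarrow> nat \<Rightarrow> real" where
  "adj_matrix X i j =
     (if i < j then of_bool (X (i, j)) else if j < i then of_bool (X (j, i)) else 0)"

definition rho :: "real \<Rightarrow> nat \<Rightarrow> real" where
  "rho \<tau> N = real N powr (- \<tau>)"

definition eps_gamma :: "real \<Rightarrow> nat \<Rightarrow> real" where
  "eps_gamma \<gamma> N = exp (- (ln (real N) powr \<gamma>))"

text \<open>Generic threshold, with the failure probability possibly depending on \<open>N\<close>.
It is the minimum of the given set, \<open>\<infinity>\<close> if the set is empty.\<close>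

definition N1_gen :: "(real \<Rightarrow> real \<Rightarrow> real) \<Rightarrow> real \<Rightarrow> real \<Rightarrow> (nat \<Rightarrow> real) \<Rightarrow> enat" where
  "N1_gen w K \<tau> e =
     (INF n\<in>{n::nat. \<forall>N\<ge>n. d_max w \<ge>
          4 * ln (4 * real N / e N) / (9 * rho \<tau> N * real N) + 2 * K / real N}. enat n)"

definition N1 :: "(real \<Rightarrow> real \<Rightarrow> real) \<Rightarrow> real \<Rightarrow> real \<Rightarrow> real \<Rightarrow> enat" where
  "N1 w K \<tau> \<epsilon> = N1_gen w K \<tau> (\<lambda>_. \<epsilon>)"

definition N1' :: "(real \<Rightarrow> real \<Rightarrow> real) \<Rightarrow> real \<Rightarrow> real \<Rightarrow> real \<Rightarrow> enat" where
  "N1' w K \<tau> \<gamma> = N1_gen w K \<tau> (eps_gamma \<gamma>)"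

end

theory Submission
  imports Defs
begin

text \<open>
  Let \<open>Y\<close> be the centred graph Laplacian, the sum over edges \<open>e = {i, j}\<close> of
  \<open>(X_e - p_e) b_e b_e^T\<close> with \<open>b_e = e_i - e_j\<close>, and let \<open>m T\<close> be the expected trace of
  \<open>exp (T Y)\<close>. For a Bernoulli variable the expectation of \<open>(X_e - p_e) q(X_e)\<close> is
  \<open>p_e (1 - p_e) (q 1 - q 0)\<close>, so \<open>m'\<close> is controlled by how much \<open>\<langle>b, exp (T H) b\<rangle>\<close> grows
  when \<open>b b^T\<close> is added to \<open>H\<close>: at most by the factor \<open>exp (T |b|^2)\<close>. This gives
  \<open>m' T \<le> c (exp (2 T) - 1) m T\<close>, a matrix Bernstein bound without Lieb's theorem; the same holds for \<open>-Y\<close>.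

  A step-graphon Laplacian splits orthogonally into multiplication by the degree on functions with
  vanishing cell means and a matrix Laplacian on step functions. The diagonal of \<open>P\<close> enters only
  the degrees and costs an additive \<open>\<rho>\<close>, which is absorbed because the tails are evaluated at
  \<open>t - \<rho>\<close> and each vertex has only \<open>N - 1\<close> potential edges.
\<close>

section \<open>Symmetric matrices on a finite index set\<close>

text \<open>The exponential of a sum of noncommuting matrices does not factor over the edges. The
  expected trace is therefore differentiated in \<open>T\<close>, where only one edge at a time is
  singled out and the others are held fixed. The constants fit together as follows. Each
  \<open>b_e\<close> has squared norm 2 and the mean Laplacian is at most
  \<open>2 * \<rho> * (N - 1)\<close>. Up to the difference between \<open>N - 1\<close> and
  \<open>N\<close>, the exponent at level \<open>t\<close> is
  \<open>s * (exp (2 * T) - 1 - 2 * T) - T * t\<close> with \<open>s = \<rho> * N\<close>. For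
  \<open>t = 4 * sqrt (s * \<Lambda>)\<close> and \<open>\<Lambda> = ln (4 * N / \<epsilon>)\<close>
  some \<open>T\<close> makes it at most \<open>- \<Lambda>\<close>, provided
  \<open>4 * \<Lambda> \<le> 9 * s\<close>; the threshold supplies this because
  \<open>d_max w \<le> 1\<close>. The trace of the identity and the two signs give the prefactor
  \<open>2 * N\<close>, hence failure probability \<open>\<epsilon> / 2\<close>, and the remaining
  factor 2 pays for lowering the level to \<open>t - \<rho>\<close>. The size \<open>N\<close> is a
  variable, so matrices are functions on a finite index set.\<close>

definition ip :: "'a set \<Rightarrow> ('a \<Rightarrow> real) \<Rightarrow> ('a \<Rightarrow> real) \<Rightarrow> real" where
  "ip I x y = (\<Sum>i\<in>I. x i * y i)"

definition mv :: "'a set \<Rightarrow> ('a \<Rightarrow> 'a \<Rightarrow> real) \<Rightarrow> ('a \<Rightarrow> real) \<Rightarrow> 'a \<Rightarrow> real" where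
  "mv I A x i = (\<Sum>j\<in>I. A i j * x j)"

definition symmetric_on :: "'a set \<Rightarrow> ('a \<Rightarrow> 'a \<Rightarrow> real) \<Rightarrow> bool" where
  "symmetric_on I A \<longleftrightarrow> (\<forall>i\<in>I. \<forall>j\<in>I. A i j = A j i)"

lemma ip_commute: "ip I x y = ip I y x"
  by (simp add: ip_def mult.commute)

lemma ip_add_left: "ip I (\<lambda>i. x i + y i) z = ip I x z + ip I y z"
  by (simp add: ip_def distrib_right sum.distrib)

lemma ip_diff_left: "ip I (\<lambda>i. x i - y i) z = ip I x z - ip I y z"
  by (simp add: ip_def left_diff_distrib sum_subtractf)

lemma ip_scale_left: "ip I (\<lambda>i. c * x i) y = c * ip I x y"
  by (simp add: ip_def sum_distrib_left mult.assoc)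

lemma ip_add_right: "ip I z (\<lambda>i. x i + y i) = ip I z x + ip I z y"
  by (simp add: ip_def distrib_left sum.distrib)

lemma ip_diff_right: "ip I z (\<lambda>i. x i - y i) = ip I z x - ip I z y"
  by (simp add: ip_def right_diff_distrib sum_subtractf)

lemma ip_scale_right: "ip I y (\<lambda>i. c * x i) = c * ip I y x"
  by (simp add: ip_commute[of I y] ip_scale_left)

lemmas ip_linear = ip_add_left ip_diff_left ip_scale_left ip_add_right ip_diff_right ip_scale_right

lemma ip_sum_left: "ip I (\<lambda>i. \<Sum>k\<in>J. f k i) y = (\<Sum>k\<in>J. ip I (f k) y)"
  unfolding ip_def sum_distrib_right by (rule sum.swap)

lemma ip_cong: "(\<And>i. i \<in> I \<Longrightarrow> x i = x' i) \<Longrightarrow> (\<And>i. i \<in> I \<Longrightarrow> y i = y' i) \<Longrightarrow> ip I x y = ip I x' y'"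
  unfolding ip_def by (rule sum.cong) auto

lemma ip_self_nonneg: "ip I x x \<ge> 0"
  unfolding ip_def by (rule sum_nonneg) auto

lemma ip_self_eq_0: "finite I \<Longrightarrow> ip I x x = 0 \<longleftrightarrow> (\<forall>i\<in>I. x i = 0)"
  unfolding ip_def by (subst sum_nonneg_eq_0_iff) auto

lemma ip_mv_symmetric:
  assumes "symmetric_on I A"
  shows "ip I (mv I A x) y = ip I x (mv I A y)"
proof -
  have "ip I (mv I A x) y = (\<Sum>i\<in>I. \<Sum>j\<in>I. A i j * x j * y i)"
    by (simp add: ip_def mv_def sum_distrib_right)
  also have "\<dots> = (\<Sum>j\<in>I. \<Sum>i\<in>I. A i j * x j * y i)"
    by (rule sum.swap)
  also have "\<dots> = (\<Sum>j\<in>I. \<Sum>i\<in>I. x j * (A j i * y i))"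
    using assms by (intro sum.cong refl) (auto simp: symmetric_on_def)
  finally show ?thesis
    by (simp add: ip_def mv_def sum_distrib_left)
qed

lemma mv_linear: "mv I A (\<lambda>i. x i + c * y i) = (\<lambda>i. mv I A x i + c * mv I A y i)"
  by (auto simp: mv_def distrib_left sum.distrib sum_distrib_left mult_ac)

lemma mv_scale: "mv I A (\<lambda>i. c * y i) = (\<lambda>i. c * mv I A y i)"
  by (auto simp: mv_def sum_distrib_left mult_ac)

lemma mv_cong: "(\<And>i. i \<in> I \<Longrightarrow> x i = y i) \<Longrightarrow> mv I A x i = mv I A y i"
  unfolding mv_def by (rule sum.cong) auto

section \<open>Orthonormal systems and the spectral theorem\<close>

definition orthonormal_on :: "'a set \<Rightarrow> 'b set \<Rightarrow> ('b \<Rightarrow> 'a \<Rightarrow> real) \<Rightarrow> bool" where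
  "orthonormal_on I J V \<longleftrightarrow> (\<forall>k\<in>J. \<forall>m\<in>J. ip I (V k) (V m) = of_bool (k = m))"

text \<open>The unit vector at \<open>i\<close> minus its orthogonal projection onto the span of the
  \<open>V k\<close>.\<close>

definition residual :: "'b set \<Rightarrow> ('b \<Rightarrow> 'a \<Rightarrow> real) \<Rightarrow> 'a \<Rightarrow> 'a \<Rightarrow> real" where
  "residual J V i x = of_bool (x = i) - (\<Sum>k\<in>J. V k i * V k x)"

lemma ip_residual:
  assumes "finite I" "finite J" "orthonormal_on I J V" "i \<in> I" "m \<in> J"
  shows "ip I (residual J V i) (V m) = 0"
proof -
  have "ip I (residual J V i) (V m)
      = ip I (\<lambda>x. of_bool (x = i)) (V m) - (\<Sum>k\<in>J. V k i * ip I (V k) (V m))"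
    unfolding residual_def by (simp add: ip_linear ip_sum_left)
  also have "ip I (\<lambda>x. of_bool (x = i)) (V m) = V m i"
    using assms by (simp add: ip_def of_bool_def if_distrib[of "\<lambda>x. x * _"] cong: if_cong)
  also have "(\<Sum>k\<in>J. V k i * ip I (V k) (V m)) = (\<Sum>k\<in>J. V k i * of_bool (k = m))"
    using assms by (intro sum.cong refl) (auto simp: orthonormal_on_def)
  also have "\<dots> = V m i"
    using assms by (simp add: of_bool_def if_distrib[of "\<lambda>x. _ * x"] cong: if_cong)
  finally show ?thesis by simp
qed

text \<open>This is the trace of the projection onto the orthogonal complement. Positivity for
  \<open>card J < card I\<close> yields a vector orthogonal to the system; vanishing for
  \<open>J = I\<close> yields completeness.\<close>

lemma sum_ip_residual:
  assumes "finite I" "finite J" "orthonormal_on I J V"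
  shows "(\<Sum>i\<in>I. ip I (residual J V i) (residual J V i)) = real (card I) - real (card J)"
proof -
  have "ip I (residual J V i) (residual J V i) = 1 - (\<Sum>k\<in>J. V k i * V k i)" if i: "i \<in> I" for i
  proof -
    have "ip I (residual J V i) (residual J V i)
        = ip I (\<lambda>x. of_bool (x = i)) (residual J V i) - (\<Sum>k\<in>J. V k i * ip I (V k) (residual J V i))"
      by (subst (1) residual_def[abs_def]) (simp add: ip_linear ip_sum_left)
    also have "(\<Sum>k\<in>J. V k i * ip I (V k) (residual J V i)) = 0"
      using ip_residual[OF assms i] by (intro sum.neutral) (simp add: ip_commute)
    also have "ip I (\<lambda>x. of_bool (x = i)) (residual J V i) = residual J V i i"
      using assms i by (simp add: ip_def of_bool_def if_distrib[of "\<lambda>x. x * _"] cong: if_cong)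
    finally show ?thesis by (simp add: residual_def[of J V i i])
  qed
  hence "(\<Sum>i\<in>I. ip I (residual J V i) (residual J V i)) = real (card I) - (\<Sum>i\<in>I. \<Sum>k\<in>J. V k i * V k i)"
    by (simp add: sum_subtractf)
  also have "(\<Sum>i\<in>I. \<Sum>k\<in>J. V k i * V k i) = (\<Sum>k\<in>J. ip I (V k) (V k))"
    unfolding ip_def by (rule sum.swap)
  also have "\<dots> = real (card J)"
    using assms(3) by (simp add: orthonormal_on_def)
  finally show ?thesis .
qed

text \<open>Vectors are functions on the whole type, so forcing them to vanish outside
  \<open>I\<close> is what places the sphere in a product of compact intervals. Tychonoff and
  closedness then give compactness in the product topology.\<close>

lemma compact_unit_sphere_orthogonal:
  fixes V :: "'b \<Rightarrow> 'a \<Rightarrow> real"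
  assumes "finite I"
  shows "compact {x. (\<forall>i. i \<notin> I \<longrightarrow> x i = 0) \<and> (\<forall>k\<in>J. ip I (V k) x = 0) \<and> ip I x x = 1}"
    (is "compact ?S")
proof -
  define B where "B = (\<lambda>i. if i \<in> I then {-1..1::real} else {0})"
  have "compactin (product_topology (\<lambda>i. euclidean) UNIV) (PiE UNIV B)"
    by (subst compactin_PiE) (auto simp: B_def)
  hence cB: "compact (PiE UNIV B)"
    by (simp add: euclidean_product_topology)
  have sub: "?S \<subseteq> PiE UNIV B"
  proof
    fix x assume x: "x \<in> ?S"
    have "\<bar>x i\<bar> \<le> 1" if "i \<in> I" for i
    proof -
      have "x i * x i \<le> ip I x x"
        unfolding ip_def using that assms by (intro member_le_sum) auto
      hence "(x i)\<^sup>2 \<le> 1" using x by (simp add: power2_eq_square)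
      thus ?thesis by (simp add: abs_square_le_1)
    qed
    thus "x \<in> PiE UNIV B" using x by (auto simp: B_def abs_le_iff)
  qed
  have cont [continuous_intros]: "continuous_on UNIV (\<lambda>x::'a \<Rightarrow> real. x i)" for i
    by (rule continuous_on_product_coordinates)
  have "?S = (\<Inter>i\<in>-I. {x. x i = 0}) \<inter> (\<Inter>k\<in>J. {x. ip I (V k) x = 0}) \<inter> {x. ip I x x = 1}"
    by auto
  moreover have "closed \<dots>"
    unfolding ip_def by (intro closed_Int closed_INT ballI closed_Collect_eq continuous_intros)
  ultimately have "closed ?S" by simp
  with cB sub show ?thesis
    using compact_Int_closed[of "PiE UNIV B" ?S] by (simp add: Int_absorb1)
qed

text \<open>First-order condition at a maximum. The test point
  \<open>a / (\<bar>c\<bar> + 1)\<close> is small enough for the linear term to dominate the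
  quadratic one.\<close>

lemma nonpos_quadratic_linear_coeff:
  fixes a c :: real
  assumes "\<And>e. 2 * e * a + e\<^sup>2 * c \<le> 0"
  shows "a = 0"
proof (rule ccontr)
  assume a: "a \<noteq> 0"
  define e where "e = a / (\<bar>c\<bar> + 1)"
  have "a = e * (\<bar>c\<bar> + 1)" by (simp add: e_def)
  hence "2 * e * a + e\<^sup>2 * c = e\<^sup>2 * (2 * (\<bar>c\<bar> + 1) + c)"
    by (simp add: power2_eq_square algebra_simps)
  moreover have "e\<^sup>2 * (2 * (\<bar>c\<bar> + 1) + c) > 0"
    using a by (intro mult_pos_pos) (auto simp: e_def)
  ultimately show False using assms[of e] by simp
qed

text \<open>A maximiser of the Rayleigh quotient on the orthogonal complement of the known
  eigenvectors is a new eigenvector. Symmetry keeps its error \<open>z = A x - \<mu> x\<close>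
  inside that complement, so \<open>z\<close> is an admissible direction of variation.\<close>

lemma symmetric_eigenvector_extension:
  fixes V :: "'b \<Rightarrow> 'a \<Rightarrow> real"
  assumes I: "finite I" and J: "finite J" "card J < card I" and A: "symmetric_on I A"
    and V: "orthonormal_on I J V"
    and eig: "\<And>k i. k \<in> J \<Longrightarrow> i \<in> I \<Longrightarrow> mv I A (V k) i = l k * V k i"
  obtains x \<mu> where "ip I x x = 1" "\<And>k. k \<in> J \<Longrightarrow> ip I (V k) x = 0"
    "\<And>i. i \<in> I \<Longrightarrow> mv I A x i = \<mu> * x i"
proof -
  let ?S = "{x. (\<forall>i. i \<notin> I \<longrightarrow> x i = 0) \<and> (\<forall>k\<in>J. ip I (V k) x = 0) \<and> ip I x x = 1}"
  \<comment> \<open>\<open>ip\<close> and \<open>mv\<close> only see values on \<open>I\<close>;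
    cutting off the rest moves a vector into the compact set without changing either.\<close>
  define restr where "restr = (\<lambda>(x::'a\<Rightarrow>real) i. if i \<in> I then x i else 0)"
  have normalize: "restr (\<lambda>i. x i / sqrt (ip I x x)) \<in> ?S"
    if "ip I x x \<noteq> 0" "\<forall>k\<in>J. ip I (V k) x = 0" for x
  proof -
    have r: "ip I y (restr z) = ip I y z" "ip I (restr y) z = ip I y z" for y z
      by (auto intro!: ip_cong simp: restr_def)
    have p: "ip I x x > 0" using that(1) ip_self_nonneg[of I x] by simp
    have "(\<lambda>i. x i / sqrt (ip I x x)) = (\<lambda>i. inverse (sqrt (ip I x x)) * x i)"
      by (simp add: field_simps)
    thus ?thesis using that p
      by (simp add: r ip_linear) (auto simp: restr_def field_simps)
  qed
  have "?S \<noteq> {}"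
  proof -
    have "(\<Sum>i\<in>I. ip I (residual J V i) (residual J V i)) \<noteq> 0"
      using sum_ip_residual[OF I J(1) V] J(2) by simp
    then obtain i where "i \<in> I" "ip I (residual J V i) (residual J V i) \<noteq> 0"
      by (meson sum.neutral)
    with ip_residual[OF I J(1) V] normalize[of "residual J V i"] show ?thesis
      by (auto simp: ip_commute)
  qed
  moreover have "continuous_on ?S (\<lambda>x. ip I x (mv I A x))"
    unfolding ip_def mv_def
    by (intro continuous_intros continuous_on_subset[OF continuous_on_product_coordinates]) auto
  ultimately have "\<exists>x\<in>?S. \<forall>y\<in>?S. ip I y (mv I A y) \<le> ip I x (mv I A x)"
    by (rule continuous_attains_sup[OF compact_unit_sphere_orthogonal[OF I, of J V]])
  then obtain x where x: "x \<in> ?S" and xmax: "\<And>y. y \<in> ?S \<Longrightarrow> ip I y (mv I A y) \<le> ip I x (mv I A x)"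
    by (elim bexE) (rule that, assumption, erule (1) bspec)
  define \<mu> where "\<mu> = ip I x (mv I A x)"
  have bound: "ip I y (mv I A y) \<le> \<mu> * ip I y y" if y: "\<forall>k\<in>J. ip I (V k) y = 0" for y
  proof (cases "ip I y y = 0")
    case True
    hence "\<forall>i\<in>I. y i = 0" using I by (simp add: ip_self_eq_0)
    hence "ip I y (mv I A y) = 0" by (simp add: ip_def)
    with True show ?thesis by simp
  next
    case False
    hence p: "ip I y y > 0" using ip_self_nonneg[of I y] by simp
    define c where "c = inverse (sqrt (ip I y y))"
    have cc: "c * c * ip I y y = 1"
      using p by (simp add: c_def field_simps)
    have eq: "(\<lambda>i. y i / sqrt (ip I y y)) = (\<lambda>i. c * y i)"
      by (simp add: c_def field_simps)
    have "ip I (restr (\<lambda>i. c * y i)) (mv I A (restr (\<lambda>i. c * y i)))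
        = ip I (\<lambda>i. c * y i) (mv I A (\<lambda>i. c * y i))"
      by (intro ip_cong mv_cong) (auto simp: restr_def)
    also have "\<dots> = c * c * ip I y (mv I A y)"
      by (simp add: mv_scale ip_linear)
    finally have "c * c * ip I y (mv I A y) \<le> \<mu>"
      using xmax[OF normalize[OF False y]] unfolding eq \<mu>_def by simp
    hence "c * c * ip I y (mv I A y) * ip I y y \<le> \<mu> * ip I y y"
      using p by (intro mult_right_mono) auto
    moreover have "c * c * ip I y (mv I A y) * ip I y y = ip I y (mv I A y)"
      using cc by (metis mult.assoc mult.commute mult_1)
    ultimately show ?thesis by simp
  qed
  define z where "z = (\<lambda>i. mv I A x i - \<mu> * x i)"
  have zJ: "ip I (V k) z = 0" if k: "k \<in> J" for k
  proof -
    have "ip I (V k) z = ip I (mv I A (V k)) x - \<mu> * ip I (V k) x"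
      by (simp add: z_def ip_linear ip_mv_symmetric[OF A])
    also have "ip I (mv I A (V k)) x = ip I (\<lambda>i. l k * V k i) x"
      using eig[OF k] by (intro ip_cong) auto
    finally show ?thesis using x k by (simp add: ip_linear)
  qed
  \<comment> \<open>Moving from \<open>x\<close> to \<open>x + e * z\<close> cannot raise the form
    above \<open>\<mu>\<close> times the squared norm. The linear coefficient of this variation is
    twice \<open>ip I z z\<close>, hence zero.\<close>
  have "ip I z z = 0"
  proof (rule nonpos_quadratic_linear_coeff)
    fix e :: real
    have "ip I (\<lambda>i. x i + e * z i) (mv I A (\<lambda>i. x i + e * z i)) \<le> \<mu> * ip I (\<lambda>i. x i + e * z i) (\<lambda>i. x i + e * z i)"
      using x zJ by (intro bound) (auto simp: ip_linear)
    moreover have "ip I x (mv I A z) = ip I z (mv I A x)"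
      by (metis ip_mv_symmetric[OF A] ip_commute)
    ultimately have "\<mu> + 2 * e * ip I z (mv I A x) + e\<^sup>2 * ip I z (mv I A z)
        \<le> \<mu> * (1 + 2 * e * ip I z x + e\<^sup>2 * ip I z z)"
      using x unfolding mv_linear
      by (simp add: ip_linear \<mu>_def[symmetric] ip_commute[of I x z] power2_eq_square algebra_simps)
    moreover have "2 * e * ip I z z = 2 * e * ip I z (mv I A x) - \<mu> * (2 * e * ip I z x)"
    proof -
      have "ip I z z = ip I z (mv I A x) - \<mu> * ip I z x"
        by (subst (2) z_def) (simp add: ip_linear)
      thus ?thesis by (simp add: right_diff_distrib)
    qed
    ultimately show "2 * e * ip I z z + e\<^sup>2 * (ip I z (mv I A z) - \<mu> * ip I z z) \<le> 0"
      by (simp add: right_diff_distrib distrib_left mult.left_commute[of "e\<^sup>2"])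
  qed
  hence "\<forall>i\<in>I. mv I A x i = \<mu> * x i"
    using I by (simp add: ip_self_eq_0 z_def)
  with x show thesis by (intro that[of x \<mu>]) simp_all
qed

text \<open>Eigenpairs are labelled by the elements of \<open>I\<close> itself: the number of labels
  is then the dimension, and no order on the eigenvalues is imposed.\<close>

definition eigenbasis :: "'a set \<Rightarrow> ('a \<Rightarrow> 'a \<Rightarrow> real) \<Rightarrow> ('a \<Rightarrow> real) \<Rightarrow> ('a \<Rightarrow> 'a \<Rightarrow> real) \<Rightarrow> bool" where
  "eigenbasis I A l V \<longleftrightarrow> orthonormal_on I I V \<and> (\<forall>k\<in>I. \<forall>i\<in>I. mv I A (V k) i = l k * V k i)"

theorem symmetric_eigenbasis_exists:
  assumes I: "finite I" and A: "symmetric_on I A"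
  shows "\<exists>l V. eigenbasis I A l V"
proof -
  have "\<exists>l V. orthonormal_on I J V \<and> (\<forall>k\<in>J. \<forall>i\<in>I. mv I A (V k) i = l k * V k i)" if "J \<subseteq> I" for J
    using finite_subset[OF that I] that
  proof (induction J rule: finite_induct)
    case empty
    show ?case by (simp add: orthonormal_on_def)
  next
    case (insert k J)
    hence "\<exists>l V. orthonormal_on I J V \<and> (\<forall>k\<in>J. \<forall>i\<in>I. mv I A (V k) i = l k * V k i)"
      by simp
    then obtain l V where V: "orthonormal_on I J V"
      and eig: "\<And>k i. k \<in> J \<Longrightarrow> i \<in> I \<Longrightarrow> mv I A (V k) i = l k * V k i"
      by blast
    have "card J < card I"
      using insert I by (intro psubset_card_mono) auto
    then obtain x \<mu> where x: "ip I x x = 1" "\<And>k. k \<in> J \<Longrightarrow> ip I (V k) x = 0"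
      "\<And>i. i \<in> I \<Longrightarrow> mv I A x i = \<mu> * x i"
      using symmetric_eigenvector_extension[OF I insert(1) _ A V eig] by blast
    have x': "ip I x (V m) = 0" if "m \<in> J" for m
      using x(2)[OF that] by (simp add: ip_commute)
    have "orthonormal_on I (insert k J) (V(k := x))"
      using V x x' insert(2) by (auto simp: orthonormal_on_def)
    moreover have "\<forall>m\<in>insert k J. \<forall>i\<in>I. mv I A ((V(k := x)) m) i = (l(k := \<mu>)) m * (V(k := x)) m i"
      using eig x insert(2) by auto
    ultimately show ?case by blast
  qed
  from this[of I] show ?thesis by (simp add: eigenbasis_def)
qed

text \<open>With as many orthonormal vectors as dimensions the residuals have total squared norm 0,
  so each unit vector equals its projection.\<close>

lemma eigenbasis_complete:
  assumes I: "finite I" and V: "eigenbasis I A l V" and i: "i \<in> I" and j: "j \<in> I"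
  shows "(\<Sum>k\<in>I. V k i * V k j) = of_bool (i = j)"
proof -
  have V': "orthonormal_on I I V" using V by (simp add: eigenbasis_def)
  have "(\<Sum>i\<in>I. ip I (residual I V i) (residual I V i)) = 0"
    using sum_ip_residual[OF I I V'] by simp
  hence "ip I (residual I V i) (residual I V i) = 0"
    using I i by (subst (asm) sum_nonneg_eq_0_iff) (auto simp: ip_self_nonneg)
  hence "residual I V i j = 0"
    using I j by (simp add: ip_self_eq_0)
  thus ?thesis by (auto simp: residual_def split: if_splits)
qed

section \<open>Matrix exponentials and rank-one updates\<close>

lemma eigenbasis_parseval:
  assumes "finite I" "eigenbasis I A l V"
  shows "(\<Sum>k\<in>I. ip I (V k) x * ip I (V k) y) = ip I x y"
proof -
  have "(\<Sum>k\<in>I. ip I (V k) x * ip I (V k) y) = (\<Sum>k\<in>I. \<Sum>i\<in>I. \<Sum>j\<in>I. V k i * V k j * (x i * y j))"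
    by (simp add: ip_def sum_product mult_ac)
  also have "\<dots> = (\<Sum>i\<in>I. \<Sum>k\<in>I. \<Sum>j\<in>I. V k i * V k j * (x i * y j))"
    by (rule sum.swap)
  also have "\<dots> = (\<Sum>i\<in>I. \<Sum>j\<in>I. \<Sum>k\<in>I. V k i * V k j * (x i * y j))"
    by (intro sum.cong refl sum.swap)
  also have "\<dots> = (\<Sum>i\<in>I. \<Sum>j\<in>I. of_bool (i = j) * (x i * y j))"
    using eigenbasis_complete[OF assms] by (intro sum.cong refl) (simp add: sum_distrib_right[symmetric])
  also have "\<dots> = (\<Sum>i\<in>I. \<Sum>j\<in>I. if i = j then x i * y j else 0)"
    by (intro sum.cong refl) auto
  also have "\<dots> = ip I x y"
    using assms(1) by (simp add: ip_def)
  finally show ?thesis .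
qed

lemma eigenbasis_ip_mv:
  assumes "symmetric_on I A" "eigenbasis I A l V" "k \<in> I"
  shows "ip I (V k) (mv I A x) = l k * ip I (V k) x"
proof -
  have "ip I (V k) (mv I A x) = ip I (mv I A (V k)) x"
    by (simp add: ip_mv_symmetric[OF assms(1)])
  also have "\<dots> = ip I (\<lambda>i. l k * V k i) x"
    using assms by (intro ip_cong) (auto simp: eigenbasis_def)
  finally show ?thesis by (simp add: ip_linear)
qed

section \<open>Growth of an exponential quadratic form under a rank-one update\<close>

text \<open>Chebyshev's sum inequality: \<open>exp (a * l)\<close> and \<open>exp (b * l)\<close>
  are both nondecreasing in \<open>l\<close>, so the products of their differences, summed over all
  pairs with weights, are nonnegative.\<close>

lemma exponential_sum_supermultiplicative:
  fixes w l :: "'a \<Rightarrow> real"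
  assumes "\<And>k. k \<in> I \<Longrightarrow> w k \<ge> 0" "a \<ge> 0" "b \<ge> 0"
  defines "g \<equiv> \<lambda>u. \<Sum>k\<in>I. exp (u * l k) * w k"
  shows "g a * g b \<le> g 0 * g (a + b)"
proof -
  let ?s = "\<lambda>k j. w k * w j * ((exp (a * l k) - exp (a * l j)) * (exp (b * l k) - exp (b * l j)))"
  have "0 \<le> (\<Sum>k\<in>I. \<Sum>j\<in>I. ?s k j)"
  proof (intro sum_nonneg)
    fix k j assume kj: "k \<in> I" "j \<in> I"
    have "0 \<le> (exp (a * l k) - exp (a * l j)) * (exp (b * l k) - exp (b * l j))"
    proof (cases "l k \<le> l j")
      case True
      thus ?thesis using assms by (intro mult_nonpos_nonpos) (auto intro: mult_left_mono)
    next
      case False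
      thus ?thesis using assms by (intro mult_nonneg_nonneg) (auto intro: mult_left_mono)
    qed
    with assms(1)[OF kj(1)] assms(1)[OF kj(2)] show "0 \<le> ?s k j"
      by (metis mult_nonneg_nonneg)
  qed
  also have "(\<Sum>k\<in>I. \<Sum>j\<in>I. ?s k j) =
     (\<Sum>k\<in>I. \<Sum>j\<in>I. (exp ((a + b) * l k) * w k) * (exp (0 * l j) * w j))
   + (\<Sum>k\<in>I. \<Sum>j\<in>I. (exp (0 * l k) * w k) * (exp ((a + b) * l j) * w j))
   - (\<Sum>k\<in>I. \<Sum>j\<in>I. (exp (a * l k) * w k) * (exp (b * l j) * w j))
   - (\<Sum>k\<in>I. \<Sum>j\<in>I. (exp (b * l k) * w k) * (exp (a * l j) * w j))"
    unfolding sum.distrib[symmetric] sum_subtractf[symmetric]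
    by (intro sum.cong refl) (simp add: distrib_right exp_add algebra_simps)
  also have "\<dots> = 2 * (g 0 * g (a + b)) - 2 * (g a * g b)"
    unfolding sum_product[symmetric] g_def by simp
  finally show ?thesis by simp
qed

text \<open>The integral inequality is phrased through an arbitrary antiderivative \<open>J\<close>
  of \<open>F\<close>, so that it can be verified by a monotonicity argument instead of by
  manipulating integrals.\<close>

lemma volterra_gronwall:
  fixes F :: "real \<Rightarrow> real"
  assumes cont: "continuous_on UNIV F" and c: "c \<ge> 0"
    and step: "\<And>u J. u \<ge> 0 \<Longrightarrow> J 0 = 0 \<Longrightarrow> (\<And>v. 0 \<le> v \<Longrightarrow> v \<le> u \<Longrightarrow> (J has_real_derivative F v) (at v))
        \<Longrightarrow> F u \<le> 1 + c * J u"
    and T: "T \<ge> 0"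
  shows "F T \<le> exp (c * T)"
proof -
  \<comment> \<open>Integrating from -1 makes 0 an interior point, so the derivative of
    \<open>J\<close> is two-sided there; subtracting the value at 0 normalises
    \<open>J 0 = 0\<close>.\<close>
  define J where "J = (\<lambda>x. integral {-1..x} F - integral {-1..0} F)"
  have J: "(J has_real_derivative F v) (at v)" if "0 \<le> v" "v \<le> T" for v
  proof -
    have "((\<lambda>x. integral {-1..x} F) has_real_derivative F v) (at v within {-1..T+1})"
      using that by (intro integral_has_real_derivative continuous_on_subset[OF cont]) auto
    hence "((\<lambda>x. integral {-1..x} F) has_real_derivative F v) (at v)"
      using that by (subst (asm) at_within_interior) auto
    thus ?thesis unfolding J_def by (auto intro!: derivative_eq_intros)
  qed
  have F: "F u \<le> 1 + c * J u" if "0 \<le> u" "u \<le> T" for u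
    using that by (intro step J) (auto simp: J_def)
  have "exp (-c * T) * (1 + c * J T) \<le> exp (-c * 0) * (1 + c * J 0)"
  proof (rule DERIV_nonpos_imp_nonincreasing[OF T])
    fix v assume v: "0 \<le> v" "v \<le> T"
    have "((\<lambda>v. exp (-c * v) * (1 + c * J v)) has_real_derivative
        exp (-c * v) * c * (F v - (1 + c * J v))) (at v)"
      by (auto intro!: derivative_eq_intros J[OF v] simp: algebra_simps)
    moreover have "exp (-c * v) * c * (F v - (1 + c * J v)) \<le> 0"
      using F[OF v] c by (intro mult_nonneg_nonpos) auto
    ultimately show "\<exists>y. ((\<lambda>v. exp (-c * v) * (1 + c * J v)) has_real_derivative y) (at v) \<and> y \<le> 0"
      by blast
  qed
  hence "1 + c * J T \<le> exp (c * T)"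
    by (simp add: J_def exp_minus field_simps)
  with F[of T] T show ?thesis by simp
qed

text \<open>Duhamel's formula: \<open>h v = \<langle>b, exp ((u - v) H) exp (v H') b\<rangle>\<close> has derivative
  \<open>g (u - v) * G v\<close>, and \<open>g (u - v) * g v \<le> g 0 * g u\<close> turns this into a Gronwall inequality
  for \<open>G / g\<close>.\<close>

lemma exp_quadratic_form_rank_one_update:
  fixes b :: "'a \<Rightarrow> real"
  assumes I: "finite I" and sym: "symmetric_on I H"
    and V: "eigenbasis I H l V" and U: "eigenbasis I H' m U"
    and H': "\<And>i j. i \<in> I \<Longrightarrow> j \<in> I \<Longrightarrow> H' i j = H i j + b i * b j"
    and T: "T \<ge> 0"
  shows "(\<Sum>k\<in>I. exp (T * m k) * (ip I (U k) b)\<^sup>2)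
    \<le> exp (T * ip I b b) * (\<Sum>k\<in>I. exp (T * l k) * (ip I (V k) b)\<^sup>2)"
proof -
  define G where "G = (\<lambda>u. \<Sum>k\<in>I. exp (u * m k) * (ip I (U k) b)\<^sup>2)"
  define g where "g = (\<lambda>u. \<Sum>k\<in>I. exp (u * l k) * (ip I (V k) b)\<^sup>2)"
  have g0: "g 0 = ip I b b"
    using eigenbasis_parseval[OF I V, of b b] by (simp add: g_def power2_eq_square)
  have mvH': "mv I H' x i = mv I H x i + ip I b x * b i" if "i \<in> I" for x i
  proof -
    have "mv I H' x i = (\<Sum>j\<in>I. H i j * x j + b j * x j * b i)"
      unfolding mv_def using that H' by (intro sum.cong refl) (simp add: algebra_simps)
    thus ?thesis by (simp add: mv_def ip_def sum.distrib sum_distrib_right)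
  qed
  \<comment> \<open>This is the matrix element of \<open>H' - H = b b^T\<close> between the two
    eigenbases. It trades the factor \<open>m j - l k\<close> for a product, which makes the double
    sum for the derivative of \<open>h\<close> factor.\<close>
  have cross: "(m j - l k) * ip I (V k) (U j) = ip I (V k) b * ip I (U j) b" if "k \<in> I" "j \<in> I" for k j
  proof -
    have "m j * ip I (V k) (U j) = ip I (V k) (\<lambda>i. m j * U j i)"
      by (simp add: ip_linear)
    also have "\<dots> = ip I (V k) (\<lambda>i. mv I H (U j) i + ip I b (U j) * b i)"
      using U that by (intro ip_cong) (auto simp: eigenbasis_def mvH'[symmetric])
    also have "\<dots> = l k * ip I (V k) (U j) + ip I b (U j) * ip I (V k) b"
      using that by (simp add: ip_linear eigenbasis_ip_mv[OF sym V])
    finally show ?thesis by (simp add: algebra_simps ip_commute[of I b])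
  qed
  show ?thesis
  proof (cases "ip I b b = 0")
    case True
    hence "ip I x b = 0" for x
      using I by (simp add: ip_self_eq_0) (simp add: ip_def)
    thus ?thesis by simp
  next
    case False
    hence bpos: "ip I b b > 0" using ip_self_nonneg[of I b] by simp
    \<comment> \<open>If \<open>g u\<close> vanished, \<open>b\<close> would be orthogonal to every
      eigenvector, and then \<open>g 0\<close>, the squared norm of \<open>b\<close>, would be 0
      too.\<close>
    have gpos: "g u > 0" for u
    proof -
      have "g u \<ge> 0" unfolding g_def by (intro sum_nonneg) auto
      moreover have "g u \<noteq> 0"
      proof
        assume "g u = 0"
        hence "\<forall>k\<in>I. ip I (V k) b = 0"
          unfolding g_def using I by (subst (asm) sum_nonneg_eq_0_iff) auto
        hence "g 0 = 0" by (simp add: g_def)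
        with g0 bpos show False by simp
      qed
      ultimately show ?thesis by simp
    qed
    have "G T / g T \<le> exp (ip I b b * T)"
    proof (rule volterra_gronwall[where F = "\<lambda>u. G u / g u"])
      show "continuous_on UNIV (\<lambda>u. G u / g u)"
        using gpos unfolding G_def g_def
        by (intro continuous_intros) (metis less_irrefl)
    next
      fix u :: real and J
      assume u: "u \<ge> 0" and J0: "J 0 = 0"
        and J: "\<And>v. 0 \<le> v \<Longrightarrow> v \<le> u \<Longrightarrow> (J has_real_derivative G v / g v) (at v)"
      \<comment> \<open>The path runs from \<open>g u\<close> at \<open>v = 0\<close> to
        \<open>G u\<close> at \<open>v = u\<close>; at each end one exponential disappears and
        Parseval in the other basis collapses a sum.\<close>
      define h where "h = (\<lambda>v. \<Sum>k\<in>I. \<Sum>j\<in>I.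
        exp ((u - v) * l k + v * m j) * (ip I (V k) b * ip I (V k) (U j) * ip I (U j) b))"
      have h0: "h 0 = g u"
      proof -
        have "h 0 = (\<Sum>k\<in>I. exp (u * l k) * ip I (V k) b * (\<Sum>j\<in>I. ip I (U j) (V k) * ip I (U j) b))"
          unfolding h_def by (simp add: sum_distrib_left ip_commute[of I "V _" "U _"] mult_ac)
        also have "\<dots> = g u"
          unfolding g_def eigenbasis_parseval[OF I U] by (simp add: power2_eq_square mult_ac)
        finally show ?thesis .
      qed
      have hu: "h u = G u"
      proof -
        have "h u = (\<Sum>j\<in>I. \<Sum>k\<in>I. exp (u * m j) * (ip I (V k) b * ip I (V k) (U j) * ip I (U j) b))"
          unfolding h_def by simp (rule sum.swap)
        also have "\<dots> = (\<Sum>j\<in>I. exp (u * m j) * ip I (U j) b * (\<Sum>k\<in>I. ip I (V k) (U j) * ip I (V k) b))"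
          by (simp add: sum_distrib_left mult_ac)
        also have "\<dots> = G u"
          unfolding G_def eigenbasis_parseval[OF I V] by (simp add: power2_eq_square mult_ac)
        finally show ?thesis .
      qed
      have h': "(h has_real_derivative g (u - v) * G v) (at v)" for v
      proof -
        have "(h has_real_derivative (\<Sum>k\<in>I. \<Sum>j\<in>I.
          exp ((u - v) * l k + v * m j) * (m j - l k) * (ip I (V k) b * ip I (V k) (U j) * ip I (U j) b))) (at v)"
          unfolding h_def by (auto intro!: derivative_eq_intros sum.cong simp: algebra_simps)
        also have "(\<Sum>k\<in>I. \<Sum>j\<in>I.
          exp ((u - v) * l k + v * m j) * (m j - l k) * (ip I (V k) b * ip I (V k) (U j) * ip I (U j) b))
          = (\<Sum>k\<in>I. \<Sum>j\<in>I. (exp ((u - v) * l k) * (ip I (V k) b)\<^sup>2) * (exp (v * m j) * (ip I (U j) b)\<^sup>2))"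
        proof (intro sum.cong refl)
          fix k j assume kj: "k \<in> I" "j \<in> I"
          have "exp ((u - v) * l k + v * m j) * (m j - l k) * (ip I (V k) b * ip I (V k) (U j) * ip I (U j) b)
            = exp ((u - v) * l k) * exp (v * m j) * ((m j - l k) * ip I (V k) (U j)) * (ip I (V k) b * ip I (U j) b)"
            by (simp add: exp_add)
          thus "exp ((u - v) * l k + v * m j) * (m j - l k) * (ip I (V k) b * ip I (V k) (U j) * ip I (U j) b)
            = (exp ((u - v) * l k) * (ip I (V k) b)\<^sup>2) * (exp (v * m j) * (ip I (U j) b)\<^sup>2)"
            unfolding cross[OF kj] by (simp add: power2_eq_square mult_ac)
        qed
        also have "\<dots> = g (u - v) * G v"
          by (simp add: g_def G_def sum_product)
        finally show ?thesis .
      qed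
      \<comment> \<open>The derivative of \<open>h\<close> is \<open>g (u - v) * g v\<close> times
        \<open>G v / g v\<close>. The first factor is at most \<open>ip I b b * g u\<close>, and the
        second is the derivative of \<open>J\<close>.\<close>
      have "h u - ip I b b * g u * J u \<le> h 0 - ip I b b * g u * J 0"
      proof (rule DERIV_nonpos_imp_nonincreasing[OF u])
        fix v assume v: "0 \<le> v" "v \<le> u"
        have "((\<lambda>v. h v - ip I b b * g u * J v) has_real_derivative
            g (u - v) * G v - ip I b b * g u * (G v / g v)) (at v)"
          by (auto intro!: derivative_eq_intros h' J[OF v])
        moreover have "g (u - v) * G v - ip I b b * g u * (G v / g v) \<le> 0"
        proof -
          have "g (u - v) * g v \<le> ip I b b * g u"
            using exponential_sum_supermultiplicative[of I "\<lambda>k. (ip I (V k) b)\<^sup>2" "u - v" v l] v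
            by (simp add: g_def[symmetric] g0[symmetric]) (simp add: g_def)
          moreover have "G v / g v \<ge> 0"
            unfolding G_def using gpos[of v] by (intro divide_nonneg_pos sum_nonneg) auto
          ultimately have "g (u - v) * g v * (G v / g v) \<le> ip I b b * g u * (G v / g v)"
            by (rule mult_right_mono)
          thus ?thesis using gpos[of v] by simp
        qed
        ultimately show "\<exists>y. ((\<lambda>v. h v - ip I b b * g u * J v) has_real_derivative y) (at v) \<and> y \<le> 0"
          by blast
      qed
      thus "G u / g u \<le> 1 + ip I b b * J u"
        using gpos[of u] by (simp add: h0 hu J0 field_simps)
    qed (use bpos T in auto)
    hence "G T \<le> exp (T * ip I b b) * g T"
      using gpos[of T] by (simp add: field_simps)
    thus ?thesis by (simp add: G_def g_def)
  qed
qed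

text \<open>\<open>eigval\<close> and \<open>eigvec\<close> project from one and the same chosen
  pair, so that values and vectors with equal label belong together.\<close>

definition eigval :: "'a set \<Rightarrow> ('a \<Rightarrow> 'a \<Rightarrow> real) \<Rightarrow> 'a \<Rightarrow> real" where
  "eigval I A = fst (SOME p. eigenbasis I A (fst p) (snd p))"

definition eigvec :: "'a set \<Rightarrow> ('a \<Rightarrow> 'a \<Rightarrow> real) \<Rightarrow> 'a \<Rightarrow> 'a \<Rightarrow> real" where
  "eigvec I A = snd (SOME p. eigenbasis I A (fst p) (snd p))"

lemma eigenbasis_eigval_eigvec:
  assumes "finite I" "symmetric_on I A"
  shows "eigenbasis I A (eigval I A) (eigvec I A)"
proof -
  have "\<exists>p. eigenbasis I A (fst p) (snd p)"
    using symmetric_eigenbasis_exists[OF assms] by auto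
  from someI_ex[OF this] show ?thesis
    by (simp add: eigval_def eigvec_def)
qed

text \<open>\<open>trexp I A u\<close> is the trace of \<open>exp (u A)\<close>, and \<open>qexp I A u b\<close> is \<open>\<langle>b, exp (u A) b\<rangle>\<close>.\<close>

definition trexp :: "'a set \<Rightarrow> ('a \<Rightarrow> 'a \<Rightarrow> real) \<Rightarrow> real \<Rightarrow> real" where
  "trexp I A u = (\<Sum>k\<in>I. exp (u * eigval I A k))"

definition qexp :: "'a set \<Rightarrow> ('a \<Rightarrow> 'a \<Rightarrow> real) \<Rightarrow> real \<Rightarrow> ('a \<Rightarrow> real) \<Rightarrow> real" where
  "qexp I A u b = (\<Sum>k\<in>I. exp (u * eigval I A k) * (ip I (eigvec I A k) b)\<^sup>2)"

lemma qexp_nonneg: "qexp I A u b \<ge> 0"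
  unfolding qexp_def by (intro sum_nonneg) auto

lemma eigenbasis_norm:
  assumes "eigenbasis I A l V" "k \<in> I"
  shows "ip I (V k) (V k) = 1"
  using assms by (auto simp: eigenbasis_def orthonormal_on_def)

lemma eigenbasis_rayleigh:
  assumes "symmetric_on I A" "eigenbasis I A l V" "k \<in> I"
  shows "ip I (V k) (mv I A (V k)) = l k"
  using eigenbasis_ip_mv[OF assms, of "V k"] eigenbasis_norm[OF assms(2,3)] by simp

lemma eigenbasis_quadratic_form:
  assumes "finite I" "symmetric_on I A" "eigenbasis I A l V"
  shows "ip I x (mv I A x) = (\<Sum>k\<in>I. l k * (ip I (V k) x)\<^sup>2)"
proof -
  have "ip I x (mv I A x) = (\<Sum>k\<in>I. ip I (V k) x * ip I (V k) (mv I A x))"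
    using eigenbasis_parseval[OF assms(1,3)] by simp
  also have "\<dots> = (\<Sum>k\<in>I. l k * (ip I (V k) x)\<^sup>2)"
    using eigenbasis_ip_mv[OF assms(2,3)] by (intro sum.cong refl) (simp add: power2_eq_square)
  finally show ?thesis .
qed

text \<open>For a symmetric matrix a bound on the quadratic form bounds every eigenvalue, and
  Parseval turns this into a bound on the operator norm.\<close>

lemma symmetric_norm_bound:
  assumes I: "finite I" and A: "symmetric_on I A"
    and bd: "\<And>x. \<bar>ip I x (mv I A x)\<bar> \<le> t * ip I x x"
  shows "ip I (mv I A x) (mv I A x) \<le> t\<^sup>2 * ip I x x"
proof -
  note V = eigenbasis_eigval_eigvec[OF I A]
  let ?l = "eigval I A" and ?V = "eigvec I A"
  have l: "(?l k)\<^sup>2 \<le> t\<^sup>2" if "k \<in> I" for k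
  proof -
    have "\<bar>?l k\<bar> \<le> t"
      using bd[of "?V k"] eigenbasis_rayleigh[OF A V that] eigenbasis_norm[OF V that] by simp
    thus ?thesis by (rule abs_le_square_iff[THEN iffD1, OF order_trans[OF _ abs_ge_self]])
  qed
  have "ip I (mv I A x) (mv I A x) = (\<Sum>k\<in>I. (?l k)\<^sup>2 * (ip I (?V k) x)\<^sup>2)"
    unfolding eigenbasis_parseval[OF I V, symmetric, of "mv I A x"]
    using eigenbasis_ip_mv[OF A V] by (intro sum.cong refl) (simp add: power2_eq_square)
  also have "\<dots> \<le> (\<Sum>k\<in>I. t\<^sup>2 * (ip I (?V k) x)\<^sup>2)"
    using l by (intro sum_mono mult_right_mono) auto
  also have "\<dots> = t\<^sup>2 * ip I x x"
    unfolding eigenbasis_parseval[OF I V, symmetric, of x] by (simp add: sum_distrib_left power2_eq_square)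
  finally show ?thesis .
qed

section \<open>A matrix Bernstein bound for Bernoulli sums of rank-one matrices\<close>

text \<open>Finite support makes every function integrable and every expectation a finite sum, which
  may be differentiated termwise.\<close>

lemma finite_set_Pi_pmf_bernoulli:
  "finite E \<Longrightarrow> finite (set_pmf (Pi_pmf E d (\<lambda>e. bernoulli_pmf (p e))))"
  by (rule finite_subset[OF set_Pi_pmf_subset']) (auto intro!: finite_PiE_dflt)

text \<open>Conditioning on all coordinates except \<open>e\<close>. Applied to a centred factor
  times \<open>q\<close>, it exposes the difference of the two values of \<open>q\<close>.\<close>

lemma expectation_Pi_bernoulli_split:
  fixes f :: "('e \<Rightarrow> bool) \<Rightarrow> real"
  assumes E: "finite E" "e \<in> E" and p: "0 \<le> p e" "p e \<le> 1"
  shows "measure_pmf.expectation (Pi_pmf E d (\<lambda>e. bernoulli_pmf (p e))) f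
    = measure_pmf.expectation (Pi_pmf (E - {e}) d (\<lambda>e. bernoulli_pmf (p e)))
        (\<lambda>Y. p e * f (Y(e := True)) + (1 - p e) * f (Y(e := False)))"
proof -
  let ?R = "Pi_pmf (E - {e}) d (\<lambda>e. bernoulli_pmf (p e))"
  have R: "finite (set_pmf ?R)"
    using E by (intro finite_set_Pi_pmf_bernoulli) auto
  have "Pi_pmf E d (\<lambda>e. bernoulli_pmf (p e)) = Pi_pmf (insert e (E - {e})) d (\<lambda>e. bernoulli_pmf (p e))"
    using E by (simp add: insert_absorb)
  also have "\<dots> = bind_pmf (bernoulli_pmf (p e)) (\<lambda>y. bind_pmf ?R (\<lambda>g. return_pmf (g(e := y))))"
    using E by (intro Pi_pmf_insert') auto
  also have "\<dots> = bind_pmf ?R (\<lambda>g. map_pmf (\<lambda>y. g(e := y)) (bernoulli_pmf (p e)))"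
    by (subst bind_commute_pmf) (simp add: map_pmf_def)
  finally have "measure_pmf.expectation (Pi_pmf E d (\<lambda>e. bernoulli_pmf (p e))) f
     = (\<Sum>g\<in>set_pmf ?R. pmf ?R g *\<^sub>R
          measure_pmf.expectation (map_pmf (\<lambda>y. g(e := y)) (bernoulli_pmf (p e))) f)"
    by (simp only:) (rule pmf_expectation_bind, use R in auto)
  also have "\<dots> = measure_pmf.expectation ?R (\<lambda>Y. p e * f (Y(e := True)) + (1 - p e) * f (Y(e := False)))"
    by (subst integral_measure_pmf_real[OF R])
      (use p in \<open>auto simp: integral_map_pmf integral_bernoulli_pmf mult_ac\<close>)
  finally show ?thesis .
qed

text \<open>Since \<open>b b^T\<close> squares to \<open>\<beta>\<close> times itself,
  \<open>mean_bound\<close> is a variance bound: the variance matrix of the sum is at most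
  \<open>\<beta> * c\<close>.\<close>

locale bernoulli_rank_one_sum =
  fixes I :: "'a set" and E :: "'e set" and b :: "'e \<Rightarrow> 'a \<Rightarrow> real" and p :: "'e \<Rightarrow> real"
    and \<beta> c :: real
  assumes finite_I: "finite I" and finite_E: "finite E"
    and p_range: "\<And>e. e \<in> E \<Longrightarrow> 0 \<le> p e \<and> p e \<le> 1"
    and norm_b: "\<And>e. e \<in> E \<Longrightarrow> ip I (b e) (b e) = \<beta>"
    and beta_pos: "\<beta> > 0"
    and mean_bound: "\<And>x. (\<Sum>e\<in>E. p e * (ip I x (b e))\<^sup>2) \<le> c * ip I x x"
begin

text \<open>The sign \<open>\<sigma>\<close> lets the largest and the smallest eigenvalue share one
  derivation.\<close>

definition cmat :: "real \<Rightarrow> ('e \<Rightarrow> bool) \<Rightarrow> 'a \<Rightarrow> 'a \<Rightarrow> real" where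
  "cmat \<sigma> X i j = (\<Sum>e\<in>E. \<sigma> * (of_bool (X e) - p e) * (b e i * b e j))"

abbreviation law :: "('e \<Rightarrow> bool) pmf" where
  "law \<equiv> Pi_pmf E False (\<lambda>e. bernoulli_pmf (p e))"

lemma symmetric_cmat: "symmetric_on I (cmat \<sigma> X)"
  by (simp add: symmetric_on_def cmat_def mult_ac)

lemma cmat_quadratic_form:
  "ip I x (mv I (cmat \<sigma> X) x) = (\<Sum>e\<in>E. \<sigma> * (of_bool (X e) - p e) * (ip I x (b e))\<^sup>2)"
proof -
  have "ip I x (mv I (cmat \<sigma> X) x)
      = (\<Sum>i\<in>I. \<Sum>j\<in>I. \<Sum>e\<in>E. \<sigma> * (of_bool (X e) - p e) * ((x i * b e i) * (x j * b e j)))"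
    by (simp add: ip_def mv_def cmat_def sum_distrib_left sum_distrib_right mult_ac)
  also have "\<dots> = (\<Sum>i\<in>I. \<Sum>e\<in>E. \<Sum>j\<in>I. \<sigma> * (of_bool (X e) - p e) * ((x i * b e i) * (x j * b e j)))"
    by (intro sum.cong refl sum.swap)
  also have "\<dots> = (\<Sum>e\<in>E. \<Sum>i\<in>I. \<Sum>j\<in>I. \<sigma> * (of_bool (X e) - p e) * ((x i * b e i) * (x j * b e j)))"
    by (rule sum.swap)
  finally show ?thesis
    unfolding power2_eq_square ip_def[of I x "b _"] sum_product unfolding sum_distrib_left .
qed

lemma finite_law: "finite (set_pmf law)"
  by (intro finite_set_Pi_pmf_bernoulli finite_E)

text \<open>The eigenbasis depends on \<open>X\<close> but not on \<open>u\<close>, so only the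
  scalar exponentials are differentiated. Each eigenvalue that comes down is a Rayleigh quotient,
  which splits over the edges.\<close>

lemma trexp_derivative:
  "(trexp I (cmat \<sigma> X) has_real_derivative
     (\<Sum>e\<in>E. \<sigma> * (of_bool (X e) - p e) * qexp I (cmat \<sigma> X) u (b e))) (at u)"
proof -
  let ?A = "cmat \<sigma> X"
  let ?l = "eigval I ?A" and ?V = "eigvec I ?A"
  note V = eigenbasis_eigval_eigvec[OF finite_I symmetric_cmat[of \<sigma> X]]
  have "(trexp I ?A has_real_derivative (\<Sum>k\<in>I. exp (u * ?l k) * ?l k)) (at u)"
    unfolding trexp_def[abs_def] by (auto intro!: derivative_eq_intros)
  also have "(\<Sum>k\<in>I. exp (u * ?l k) * ?l k)
      = (\<Sum>k\<in>I. \<Sum>e\<in>E. \<sigma> * (of_bool (X e) - p e) * (exp (u * ?l k) * (ip I (?V k) (b e))\<^sup>2))"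
  proof (intro sum.cong refl)
    fix k assume "k \<in> I"
    have "?l k = (\<Sum>e\<in>E. \<sigma> * (of_bool (X e) - p e) * (ip I (?V k) (b e))\<^sup>2)"
      using eigenbasis_rayleigh[OF symmetric_cmat V \<open>k \<in> I\<close>] by (simp add: cmat_quadratic_form)
    hence "exp (u * ?l k) * ?l k
        = exp (u * ?l k) * (\<Sum>e\<in>E. \<sigma> * (of_bool (X e) - p e) * (ip I (?V k) (b e))\<^sup>2)"
      by (rule arg_cong)
    thus "exp (u * ?l k) * ?l k
        = (\<Sum>e\<in>E. \<sigma> * (of_bool (X e) - p e) * (exp (u * ?l k) * (ip I (?V k) (b e))\<^sup>2))"
      by (simp add: sum_distrib_left mult_ac)
  qed
  also have "\<dots> = (\<Sum>e\<in>E. \<sigma> * (of_bool (X e) - p e) * qexp I ?A u (b e))"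
    by (subst sum.swap) (simp add: qexp_def sum_distrib_left)
  finally show ?thesis .
qed

text \<open>The weights \<open>exp (u * l)\<close> are positive, so \<open>mean_bound\<close> can be
  applied to each unit eigenvector separately.\<close>

lemma mean_qexp_le: "(\<Sum>e\<in>E. p e * qexp I A u (b e)) \<le> c * trexp I A u"
  if A: "symmetric_on I A"
proof -
  note V = eigenbasis_eigval_eigvec[OF finite_I A]
  let ?l = "eigval I A" and ?V = "eigvec I A"
  have "(\<Sum>e\<in>E. p e * qexp I A u (b e))
      = (\<Sum>k\<in>I. exp (u * ?l k) * (\<Sum>e\<in>E. p e * (ip I (?V k) (b e))\<^sup>2))"
    unfolding qexp_def sum_distrib_left by (subst sum.swap) (simp add: mult_ac)
  also have "\<dots> \<le> (\<Sum>k\<in>I. exp (u * ?l k) * c)"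
  proof (intro sum_mono mult_left_mono)
    fix k assume "k \<in> I"
    show "(\<Sum>e\<in>E. p e * (ip I (?V k) (b e))\<^sup>2) \<le> c"
      using mean_bound[of "?V k"] eigenbasis_norm[OF V \<open>k \<in> I\<close>] by simp
  qed auto
  finally show ?thesis by (simp add: trexp_def sum_distrib_left mult_ac)
qed

text \<open>Inserting the edge adds \<open>\<sigma> b b^T\<close>. For \<open>\<sigma> = 1\<close>
  the rank-one update applies directly; for \<open>\<sigma> = -1\<close> the matrix without the edge
  is the updated one and the roles are exchanged. Both bounds refer to the state without the edge,
  which carries the weight \<open>1 - p e\<close>.\<close>

lemma qexp_flip:
  assumes e: "e \<in> E" and \<sigma>: "\<sigma> = 1 \<or> \<sigma> = -1" and u: "u \<ge> 0"
  shows "\<sigma> * (qexp I (cmat \<sigma> (Y(e := True))) u (b e) - qexp I (cmat \<sigma> (Y(e := False))) u (b e))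
    \<le> (exp (\<beta> * u) - 1) * qexp I (cmat \<sigma> (Y(e := False))) u (b e)"
proof -
  let ?A1 = "cmat \<sigma> (Y(e := True))" and ?A0 = "cmat \<sigma> (Y(e := False))"
  note V1 = eigenbasis_eigval_eigvec[OF finite_I symmetric_cmat[of \<sigma> "Y(e := True)"]]
  note V0 = eigenbasis_eigval_eigvec[OF finite_I symmetric_cmat[of \<sigma> "Y(e := False)"]]
  have diff: "?A1 i j = ?A0 i j + \<sigma> * (b e i * b e j)" for i j
    unfolding cmat_def using e finite_E
    by (simp add: sum.remove[of E e] algebra_simps)
  have z: "exp (\<beta> * u) \<ge> 1" using u beta_pos by simp
  from \<sigma> show ?thesis
  proof
    assume s: "\<sigma> = 1"
    have "qexp I ?A1 u (b e) \<le> exp (u * ip I (b e) (b e)) * qexp I ?A0 u (b e)"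
      unfolding qexp_def
      by (rule exp_quadratic_form_rank_one_update[OF finite_I symmetric_cmat V0 V1 _ u])
        (use diff in \<open>simp add: s\<close>)
    thus ?thesis using e by (simp add: s norm_b algebra_simps)
  next
    assume s: "\<sigma> = -1"
    have "qexp I ?A0 u (b e) \<le> exp (u * ip I (b e) (b e)) * qexp I ?A1 u (b e)"
      unfolding qexp_def
      by (rule exp_quadratic_form_rank_one_update[OF finite_I symmetric_cmat V1 V0 _ u])
        (use diff in \<open>simp add: s\<close>)
    hence "qexp I ?A0 u (b e) \<le> exp (\<beta> * u) * qexp I ?A1 u (b e)"
      using e by (simp add: norm_b mult_ac)
    hence q: "qexp I ?A0 u (b e) / exp (\<beta> * u) \<le> qexp I ?A1 u (b e)"
      by (simp add: divide_le_eq mult_ac)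
    \<comment> \<open>The exchanged update gives the factor \<open>1 - 1 / z\<close> with
      \<open>z = exp (\<beta> * u)\<close>; by \<open>z + 1 / z \<ge> 2\<close> it is at most
      \<open>z - 1\<close>.\<close>
    have "2 \<le> exp (\<beta> * u) + 1 / exp (\<beta> * u)"
      using z sum_squares_ge_zero[of "exp (\<beta> * u) - 1" 0]
      by (simp add: field_simps)
    hence "2 * qexp I ?A0 u (b e) \<le> (exp (\<beta> * u) + 1 / exp (\<beta> * u)) * qexp I ?A0 u (b e)"
      by (intro mult_right_mono qexp_nonneg)
    with q show ?thesis by (simp add: s algebra_simps)
  qed
qed

lemma expectation_centered_qexp_le:
  assumes e: "e \<in> E" and \<sigma>: "\<sigma> = 1 \<or> \<sigma> = -1" and u: "u \<ge> 0"
  shows "measure_pmf.expectation law (\<lambda>X. \<sigma> * (of_bool (X e) - p e) * qexp I (cmat \<sigma> X) u (b e))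
    \<le> (exp (\<beta> * u) - 1) * (p e * measure_pmf.expectation law (\<lambda>X. qexp I (cmat \<sigma> X) u (b e)))"
proof -
  let ?R = "Pi_pmf (E - {e}) False (\<lambda>e. bernoulli_pmf (p e))"
  let ?q = "\<lambda>X. qexp I (cmat \<sigma> X) u (b e)"
  have R: "finite (set_pmf ?R)"
    using finite_E by (intro finite_set_Pi_pmf_bernoulli) auto
  have p: "0 \<le> p e" "p e \<le> 1" using p_range[OF e] by auto
  have "measure_pmf.expectation law (\<lambda>X. \<sigma> * (of_bool (X e) - p e) * ?q X)
      = measure_pmf.expectation ?R (\<lambda>Y. p e * (1 - p e) * (\<sigma> * (?q (Y(e := True)) - ?q (Y(e := False)))))"
    by (subst expectation_Pi_bernoulli_split[where p = p, OF finite_E e p]) (simp add: algebra_simps)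
  also have "\<dots> \<le> measure_pmf.expectation ?R (\<lambda>Y. (exp (\<beta> * u) - 1) * (p e *
      (p e * ?q (Y(e := True)) + (1 - p e) * ?q (Y(e := False)))))"
  proof (intro integral_mono integrable_measure_pmf_finite R)
    fix Y
    have z: "exp (\<beta> * u) - 1 \<ge> 0" using u beta_pos by simp
    have "p e * (1 - p e) * (\<sigma> * (?q (Y(e := True)) - ?q (Y(e := False))))
       \<le> p e * (1 - p e) * ((exp (\<beta> * u) - 1) * ?q (Y(e := False)))"
      using p qexp_flip[OF e \<sigma> u] by (intro mult_left_mono) auto
    \<comment> \<open>The flip bound leaves only the state without the edge. Adding the nonnegative
      term for the other state restores the full conditional expectation of the quadratic
      form.\<close>
    also have "\<dots> \<le> \<dots> + (exp (\<beta> * u) - 1) * (p e * (p e * ?q (Y(e := True))))"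
      using p z by (simp add: qexp_nonneg)
    finally show "p e * (1 - p e) * (\<sigma> * (?q (Y(e := True)) - ?q (Y(e := False))))
      \<le> (exp (\<beta> * u) - 1) * (p e * (p e * ?q (Y(e := True)) + (1 - p e) * ?q (Y(e := False))))"
      by (simp add: algebra_simps)
  qed
  also have "\<dots> = (exp (\<beta> * u) - 1) * (p e * measure_pmf.expectation law ?q)"
    by (subst expectation_Pi_bernoulli_split[where p = p, OF finite_E e p]) simp
  finally show ?thesis .
qed

lemma expectation_trexp_le:
  assumes \<sigma>: "\<sigma> = 1 \<or> \<sigma> = -1" and T: "T \<ge> 0"
  shows "measure_pmf.expectation law (\<lambda>X. trexp I (cmat \<sigma> X) T)
    \<le> real (card I) * exp (c * ((exp (\<beta> * T) - 1) / \<beta> - T))"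
proof -
  define m where "m = (\<lambda>u. measure_pmf.expectation law (\<lambda>X. trexp I (cmat \<sigma> X) u))"
  have int: "integrable (measure_pmf law) f" for f :: "_ \<Rightarrow> real"
    by (intro integrable_measure_pmf_finite finite_law)
  define m' where "m' = (\<lambda>u. measure_pmf.expectation law
    (\<lambda>X. \<Sum>e\<in>E. \<sigma> * (of_bool (X e) - p e) * qexp I (cmat \<sigma> X) u (b e)))"
  have exp_sum: "measure_pmf.expectation law f = (\<Sum>X\<in>set_pmf law. f X * pmf law X)" for f :: "_ \<Rightarrow> real"
    by (rule integral_measure_pmf_real[OF finite_law]) auto
  have deriv: "(m has_real_derivative m' u) (at u)" for u
    unfolding m_def m'_def exp_sum
    by (intro DERIV_sum DERIV_cmult_right trexp_derivative)
  have m'_le: "m' u \<le> c * (exp (\<beta> * u) - 1) * m u" if u: "u \<ge> 0" for u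
  proof -
    have "m' u = (\<Sum>e\<in>E. measure_pmf.expectation law
        (\<lambda>X. \<sigma> * (of_bool (X e) - p e) * qexp I (cmat \<sigma> X) u (b e)))"
      unfolding m'_def by (rule Bochner_Integration.integral_sum) (rule int)
    also have "\<dots> \<le> (\<Sum>e\<in>E. (exp (\<beta> * u) - 1) *
        (p e * measure_pmf.expectation law (\<lambda>X. qexp I (cmat \<sigma> X) u (b e))))"
      by (intro sum_mono expectation_centered_qexp_le \<sigma> u)
    also have "\<dots> = (exp (\<beta> * u) - 1) *
        measure_pmf.expectation law (\<lambda>X. \<Sum>e\<in>E. p e * qexp I (cmat \<sigma> X) u (b e))"
      by (subst Bochner_Integration.integral_sum) (auto intro: int simp: sum_distrib_left)
    also have "\<dots> \<le> (exp (\<beta> * u) - 1) * measure_pmf.expectation law (\<lambda>X. c * trexp I (cmat \<sigma> X) u)"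
      using u beta_pos by (intro mult_left_mono integral_mono int mean_qexp_le symmetric_cmat) auto
    finally show ?thesis by (simp add: m_def mult_ac)
  qed
  \<comment> \<open>The antiderivative of the growth rate \<open>c * (exp (\<beta> * u) - 1)\<close>
    with value 0 at 0; \<open>exp (- \<psi> u)\<close> is the integrating factor.\<close>
  define \<psi> where "\<psi> = (\<lambda>u. c * ((exp (\<beta> * u) - 1) / \<beta> - u))"
  have "m T * exp (- \<psi> T) \<le> m 0 * exp (- \<psi> 0)"
  proof (rule DERIV_nonpos_imp_nonincreasing[OF T])
    fix u assume u: "0 \<le> u" "u \<le> T"
    have "(\<psi> has_real_derivative c * (exp (\<beta> * u) - 1)) (at u)"
      unfolding \<psi>_def using beta_pos by (auto intro!: derivative_eq_intros simp: field_simps)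
    hence "((\<lambda>u. m u * exp (- \<psi> u)) has_real_derivative
        (m' u - c * (exp (\<beta> * u) - 1) * m u) * exp (- \<psi> u)) (at u)"
      by (auto intro!: derivative_eq_intros deriv simp: algebra_simps)
    moreover have "(m' u - c * (exp (\<beta> * u) - 1) * m u) * exp (- \<psi> u) \<le> 0"
      using m'_le[OF u(1)] by (intro mult_nonpos_nonneg) auto
    ultimately show "\<exists>y. ((\<lambda>u. m u * exp (- \<psi> u)) has_real_derivative y) (at u) \<and> y \<le> 0"
      by blast
  qed
  moreover have "m 0 = real (card I)" "\<psi> 0 = 0"
    by (simp_all add: m_def \<psi>_def trexp_def)
  ultimately have "m T \<le> real (card I) * exp (\<psi> T)"
    by (simp add: exp_minus field_simps)
  thus ?thesis by (simp add: m_def \<psi>_def)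
qed

text \<open>Chernoff's method: all terms of the trace are positive, so a single eigenvalue above
  \<open>t\<close> pushes it above \<open>exp (T * t)\<close>.\<close>

lemma prob_eigval_gt_le:
  assumes \<sigma>: "\<sigma> = 1 \<or> \<sigma> = -1" and T: "T \<ge> 0"
  shows "measure_pmf.prob law {X. \<exists>k\<in>I. eigval I (cmat \<sigma> X) k > t}
    \<le> real (card I) * exp (c * ((exp (\<beta> * T) - 1) / \<beta> - T) - T * t)"
proof -
  let ?S = "{X. \<exists>k\<in>I. eigval I (cmat \<sigma> X) k > t}"
  have int: "integrable (measure_pmf law) f" for f :: "_ \<Rightarrow> real"
    by (intro integrable_measure_pmf_finite finite_law)
  have "measure_pmf.prob law ?S = measure_pmf.expectation law (indicator ?S)"
    by simp
  also have "\<dots> \<le> measure_pmf.expectation law (\<lambda>X. exp (- T * t) * trexp I (cmat \<sigma> X) T)"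
  proof (intro integral_mono int)
    fix X
    have tr: "exp (T * eigval I (cmat \<sigma> X) k) \<le> trexp I (cmat \<sigma> X) T" if "k \<in> I" for k
      unfolding trexp_def using that finite_I by (intro member_le_sum) auto
    show "indicator ?S X \<le> exp (- T * t) * trexp I (cmat \<sigma> X) T"
    proof (cases "X \<in> ?S")
      case True
      then obtain k where k: "k \<in> I" "eigval I (cmat \<sigma> X) k > t" by auto
      have "1 = exp (- T * t) * exp (T * t)"
        by (simp add: exp_add[symmetric])
      also have "\<dots> \<le> exp (- T * t) * exp (T * eigval I (cmat \<sigma> X) k)"
        using k T by (intro mult_left_mono) (auto intro: mult_left_mono)
      also have "\<dots> \<le> exp (- T * t) * trexp I (cmat \<sigma> X) T"
        using tr[OF k(1)] by (intro mult_left_mono) auto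
      finally show ?thesis using True by simp
    next
      case False
      thus ?thesis by (auto simp: trexp_def intro!: sum_nonneg mult_nonneg_nonneg)
    qed
  qed
  also have "\<dots> \<le> exp (- T * t) * (real (card I) * exp (c * ((exp (\<beta> * T) - 1) / \<beta> - T)))"
    using expectation_trexp_le[OF \<sigma> T] by simp
  finally show ?thesis
    by (simp add: exp_diff[of "_ * _"] exp_minus divide_inverse mult_ac)
qed

theorem prob_quadratic_form_bounded_ge:
  assumes T: "T \<ge> 0"
  shows "measure_pmf.prob law {X. \<forall>x. \<bar>ip I x (mv I (cmat 1 X) x)\<bar> \<le> t * ip I x x}
    \<ge> 1 - 2 * real (card I) * exp (c * ((exp (\<beta> * T) - 1) / \<beta> - T) - T * t)"
proof -
  let ?S = "\<lambda>\<sigma>. {X. \<exists>k\<in>I. eigval I (cmat \<sigma> X) k > t}"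
  let ?G = "{X. \<forall>x. \<bar>ip I x (mv I (cmat 1 X) x)\<bar> \<le> t * ip I x x}"
  have upper: "\<sigma> * ip I x (mv I (cmat 1 X) x) \<le> t * ip I x x" if X: "X \<notin> ?S \<sigma>" for \<sigma> X x
  proof -
    note V = eigenbasis_eigval_eigvec[OF finite_I symmetric_cmat[of \<sigma> X]]
    have "\<sigma> * ip I x (mv I (cmat 1 X) x) = ip I x (mv I (cmat \<sigma> X) x)"
      by (simp add: cmat_quadratic_form sum_distrib_left mult_ac)
    also have "\<dots> \<le> (\<Sum>k\<in>I. t * (ip I (eigvec I (cmat \<sigma> X) k) x)\<^sup>2)"
      unfolding eigenbasis_quadratic_form[OF finite_I symmetric_cmat V]
      using X by (intro sum_mono mult_right_mono) (auto simp: not_less)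
    also have "\<dots> = t * ip I x x"
      unfolding eigenbasis_parseval[OF finite_I V, symmetric, of x] by (simp add: sum_distrib_left power2_eq_square)
    finally show ?thesis .
  qed
  \<comment> \<open>If the two-sided bound fails for some vector, then for one of the signs some
    eigenvalue exceeds \<open>t\<close>; the union bound over the signs causes the factor 2.\<close>
  have "- ?G \<subseteq> ?S 1 \<union> ?S (-1)"
    using upper[of _ 1] upper[of _ "-1"] by (force simp: abs_le_iff)
  hence "measure_pmf.prob law (- ?G) \<le> measure_pmf.prob law (?S 1 \<union> ?S (-1))"
    by (intro measure_pmf.finite_measure_mono) auto
  also have "\<dots> \<le> measure_pmf.prob law (?S 1) + measure_pmf.prob law (?S (-1))"
    by (intro measure_Un_le) auto
  also have "\<dots> \<le> 2 * real (card I) * exp (c * ((exp (\<beta> * T) - 1) / \<beta> - T) - T * t)"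
    using prob_eigval_gt_le[OF _ T, of 1 t] prob_eigval_gt_le[OF _ T, of "-1" t] by simp
  finally show ?thesis
    using measure_pmf.prob_compl[of ?G law] by (simp add: Compl_eq_Diff_UNIV)
qed

end

section \<open>Step graphons and their Laplacians\<close>

text \<open>Reading off the label from a ceiling gives disjointness and covering at once; the
  \<open>max 1\<close> assigns the point 0 to the closed first cell.\<close>

lemma cell_iff:
  assumes "N \<ge> 1" "i \<ge> 1"
  shows "x \<in> cell N i \<longleftrightarrow> 0 \<le> x \<and> i = max 1 (nat \<lceil>x * real N\<rceil>)"
proof (cases "i = 1")
  case True
  have "x \<le> 1 / real N \<longleftrightarrow> x * real N \<le> 1"
    using assms by (simp add: field_simps)
  also have "\<dots> \<longleftrightarrow> \<lceil>x * real N\<rceil> \<le> 1" by (simp add: ceiling_le_iff)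
  also have "\<dots> \<longleftrightarrow> 1 = max 1 (nat \<lceil>x * real N\<rceil>)" by arith
  finally show ?thesis using True by (simp add: cell_def)
next
  case False
  have "x \<in> cell N i \<longleftrightarrow> real i - 1 < x * real N \<and> x * real N \<le> real i"
    using assms False by (simp add: cell_def field_simps)
  also have "\<dots> \<longleftrightarrow> \<lceil>x * real N\<rceil> = int i"
    by (simp add: ceiling_eq_iff)
  also have "\<dots> \<longleftrightarrow> 0 \<le> x \<and> i = max 1 (nat \<lceil>x * real N\<rceil>)"
  proof
    assume *: "\<lceil>x * real N\<rceil> = int i"
    hence "x * real N > real i - 1" by (simp add: ceiling_eq_iff)
    hence "x * real N \<ge> 0" using assms by linarith
    thus "0 \<le> x \<and> i = max 1 (nat \<lceil>x * real N\<rceil>)"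
      using * assms by (simp add: zero_le_mult_iff)
  next
    assume "0 \<le> x \<and> i = max 1 (nat \<lceil>x * real N\<rceil>)"
    thus "\<lceil>x * real N\<rceil> = int i" using False by (auto simp: max_def split: if_splits)
  qed
  finally show ?thesis .
qed

text \<open>The partition is stated as an identity of indicators, so that integrals and
  integrability split over cells by linearity.\<close>

lemma unit_interval_cells:
  assumes "N \<ge> 1"
  shows "indicator {0..1} x = (\<Sum>i\<in>{1..N}. indicator (cell N i) x :: real)"
proof -
  let ?k = "max 1 (nat \<lceil>x * real N\<rceil>)"
  have "(\<Sum>i\<in>{1..N}. indicator (cell N i) x :: real) = (\<Sum>i\<in>{1..N}. if i = ?k then of_bool (0 \<le> x) else 0)"
    using assms by (intro sum.cong refl) (auto simp: cell_iff indicator_def)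
  also have "\<dots> = of_bool (0 \<le> x \<and> ?k \<le> N)"
    by simp
  also have "?k \<le> N \<longleftrightarrow> x \<le> 1"
  proof -
    have "?k \<le> N \<longleftrightarrow> \<lceil>x * real N\<rceil> \<le> int N" using assms by arith
    also have "\<dots> \<longleftrightarrow> x * real N \<le> 1 * real N" by (simp add: ceiling_le_iff)
    also have "\<dots> \<longleftrightarrow> x \<le> 1" using assms by (subst mult_le_cancel_right_pos) auto
    finally show ?thesis .
  qed
  finally show ?thesis by (simp add: indicator_def)
qed

lemma obtain_cell:
  assumes "N \<ge> 1" "x \<in> {0..1}"
  obtains i where "i \<in> {1..N}" "x \<in> cell N i"
proof -
  have "(\<Sum>i\<in>{1..N}. indicator (cell N i) x :: real) \<noteq> 0"
    using unit_interval_cells[OF assms(1), of x] assms(2) by simp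
  then obtain i where "i \<in> {1..N}" "indicator (cell N i) x \<noteq> (0::real)"
    by (meson sum.neutral)
  thus ?thesis using that by (auto simp: indicator_def split: if_splits)
qed

lemma cell_unique:
  assumes "N \<ge> 1" "i \<ge> 1" "j \<ge> 1" "x \<in> cell N i" "x \<in> cell N j"
  shows "i = j"
  using assms by (simp add: cell_iff)

lemma cell_sets [measurable]: "cell N i \<in> sets borel"
  by (simp add: cell_def)

lemma cell_subset:
  assumes "i \<in> {1..N}"
  shows "cell N i \<subseteq> {0..1}"
proof
  fix x assume "x \<in> cell N i"
  have "indicator (cell N i) x \<le> (\<Sum>i\<in>{1..N}. indicator (cell N i) x :: real)"
    using assms by (intro member_le_sum) auto
  also have "\<dots> = indicator {0..1} x"
    using assms by (intro unit_interval_cells[symmetric]) auto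
  finally show "x \<in> {0..1}" using \<open>x \<in> cell N i\<close> by (cases "x \<in> {0..1}") (auto simp: indicator_def)
qed

lemma emeasure_cell:
  assumes "N \<ge> 1"
  shows "emeasure lborel (cell N i) = ennreal (1 / real N)"
proof -
  have "real i / real N - (real i - 1) / real N = 1 / real N"
    by (simp add: diff_divide_distrib)
  moreover have "(real i - 1) / real N \<le> real i / real N"
    by (simp add: divide_right_mono)
  ultimately show ?thesis using assms
    by (simp add: cell_def)
qed

lemma set_integral_const_cell:
  assumes "N \<ge> 1"
  shows "set_integrable lborel (cell N i) (\<lambda>_. c :: real)" "(LINT x:cell N i|lborel. c) = c / real N"
proof -
  show "set_integrable lborel (cell N i) (\<lambda>_. c)"
    unfolding set_integrable_def using assms
    by (intro integrable_scaleR_left) (auto intro!: integrable_real_indicator simp: emeasure_cell)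
  show "(LINT x:cell N i|lborel. c) = c / real N"
    using assms by (subst set_integral_const) (auto simp: emeasure_cell measure_def)
qed

lemma set_integral_const_unit: "set_integrable lborel {0..1::real} (\<lambda>_. c :: real)"
  "(LINT x:{0..1::real}|lborel. c) = c"
proof -
  show "set_integrable lborel {0..1::real} (\<lambda>_. c)"
    unfolding set_integrable_def
    by (intro integrable_scaleR_left) (auto intro!: integrable_real_indicator)
  show "(LINT x:{0..1::real}|lborel. c) = c"
    by (subst set_integral_const) auto
qed

lemma set_integral_cells:
  fixes h :: "real \<Rightarrow> real"
  assumes "N \<ge> 1" "\<And>i. i \<in> {1..N} \<Longrightarrow> set_integrable lborel (cell N i) h"
  shows "set_integrable lborel {0..1} h"
    and "(LINT x:{0..1}|lborel. h x) = (\<Sum>i\<in>{1..N}. LINT x:cell N i|lborel. h x)"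
proof -
  have eq: "indicator {0..1} x *\<^sub>R h x = (\<Sum>i\<in>{1..N}. indicator (cell N i) x *\<^sub>R h x)" for x
    unfolding unit_interval_cells[OF assms(1)] by (rule scaleR_sum_left)
  have int: "integrable lborel (\<lambda>x. indicator (cell N i) x *\<^sub>R h x)" if "i \<in> {1..N}" for i
    using assms(2)[OF that] by (simp only: set_integrable_def)
  show "set_integrable lborel {0..1} h"
    unfolding set_integrable_def eq by (intro Bochner_Integration.integrable_sum int)
  show "(LINT x:{0..1}|lborel. h x) = (\<Sum>i\<in>{1..N}. LINT x:cell N i|lborel. h x)"
    unfolding set_lebesgue_integral_def eq by (intro Bochner_Integration.integral_sum int)
qed

text \<open>A non-integrable \<open>g\<close> has integral 0 by convention, and nonnegativity of
  \<open>f\<close> covers that case. Squared Laplacians can thus be estimated from a pointwise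
  majorant.\<close>

lemma set_integral_mono_nonneg:
  fixes f g :: "'a \<Rightarrow> real"
  assumes "set_integrable M A f" "\<And>x. x \<in> A \<Longrightarrow> g x \<le> f x" "\<And>x. x \<in> A \<Longrightarrow> 0 \<le> f x"
  shows "(LINT x:A|M. g x) \<le> (LINT x:A|M. f x)"
  using assms unfolding set_integrable_def set_lebesgue_integral_def
  by (intro integral_mono') (auto simp: indicator_def)

section \<open>Square-integrable functions and operator norm estimates\<close>

lemma L2_space_integrable:
  assumes "f \<in> L2_space"
  shows "set_integrable lborel {0..1} f"
proof -
  have "set_integrable lborel {0..1} (\<lambda>x. 1 + (f x)\<^sup>2)"
    using assms set_integral_const_unit by (intro set_integral_add) (auto simp: L2_space_def)
  thus ?thesis
  proof (rule set_integrable_bound)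
    show "set_borel_measurable lborel {0..1} f"
      using assms by (auto simp: L2_space_def set_borel_measurable_def)
    have "\<bar>f x\<bar> \<le> 1 + (f x)\<^sup>2" for x
      using sum_squares_ge_zero[of "\<bar>f x\<bar> - 1" 0] zero_le_square[of "f x"]
      by (simp add: power2_eq_square algebra_simps)
    thus "AE x in lborel. x \<in> {0..1} \<longrightarrow> norm (f x) \<le> norm (1 + (f x)\<^sup>2)"
      by simp
  qed
qed

text \<open>On a space of measure 1 the pointwise bound
  \<open>\<bar>f\<bar> \<le> (f^2 + 1) / 2\<close> replaces Cauchy-Schwarz.\<close>

lemma L2_integral_abs_le:
  assumes "f \<in> L2_space" "(LINT x:{0..1}|lborel. (f x)\<^sup>2) \<le> 1"
  shows "(LINT x:{0..1}|lborel. \<bar>f x\<bar>) \<le> 1"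
proof -
  have int: "set_integrable lborel {0..1} (\<lambda>x. (f x)\<^sup>2)"
    using assms by (simp add: L2_space_def)
  have "(LINT x:{0..1}|lborel. \<bar>f x\<bar>) \<le> (LINT x:{0..1}|lborel. (1/2) * ((f x)\<^sup>2 + 1))"
  proof (intro set_integral_mono)
    fix x
    show "\<bar>f x\<bar> \<le> (1/2) * ((f x)\<^sup>2 + 1)"
      using sum_squares_ge_zero[of "\<bar>f x\<bar> - 1" 0] by (simp add: power2_eq_square algebra_simps)
  qed (intro set_integrable_abs set_integrable_mult_right set_integral_add
      L2_space_integrable assms int set_integral_const_unit)+
  also have "\<dots> = (1/2) * ((LINT x:{0..1}|lborel. (f x)\<^sup>2) + 1)"
    using int by (simp add: set_integral_const_unit)
  finally show ?thesis using assms(2) by simp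
qed

lemma op_norm_le:
  assumes "C \<ge> 0" "\<And>f. f \<in> L2_space \<Longrightarrow> (LINT x:{0..1}|lborel. (f x)\<^sup>2) \<le> 1 \<Longrightarrow>
    (LINT x:{0..1}|lborel. (T f x)\<^sup>2) \<le> C\<^sup>2"
  shows "op_norm T \<le> ereal C"
  unfolding op_norm_def
proof (rule SUP_least)
  fix f assume "f \<in> {f \<in> L2_space. L2_norm f \<le> 1}"
  hence "(LINT x:{0..1}|lborel. (T f x)\<^sup>2) \<le> C\<^sup>2"
    by (intro assms(2)) (auto simp: L2_norm_def)
  thus "ereal (L2_norm (T f)) \<le> ereal C"
    using assms(1) by (simp add: L2_norm_def real_le_lsqrt)
qed

text \<open>Minkowski's inequality through Young's inequality with weight
  \<open>\<beta> / \<alpha>\<close> on the mixed term. This weight is the one for which the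
  integrated bound is exactly \<open>(\<alpha> + \<beta>)^2\<close>.\<close>

lemma minkowski_square_le:
  fixes a b h :: "real \<Rightarrow> real"
  assumes a: "set_integrable M S (\<lambda>x. (a x)\<^sup>2)" "(LINT x:S|M. (a x)\<^sup>2) \<le> \<alpha>\<^sup>2"
    and b: "set_integrable M S (\<lambda>x. (b x)\<^sup>2)" "(LINT x:S|M. (b x)\<^sup>2) \<le> \<beta>\<^sup>2"
    and pos: "\<alpha> > 0" "\<beta> > 0"
    and h: "\<And>x. x \<in> S \<Longrightarrow> \<bar>h x\<bar> \<le> \<bar>a x\<bar> + \<bar>b x\<bar>"
  shows "(LINT x:S|M. (h x)\<^sup>2) \<le> (\<alpha> + \<beta>)\<^sup>2"
proof -
  have "(LINT x:S|M. (h x)\<^sup>2) \<le> (LINT x:S|M. (1 + \<beta> / \<alpha>) * (a x)\<^sup>2 + (1 + \<alpha> / \<beta>) * (b x)\<^sup>2)"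
  proof (rule set_integral_mono_nonneg)
    fix x assume "x \<in> S"
    define r where "r = sqrt (\<beta> / \<alpha>)"
    have r: "r > 0" "r\<^sup>2 = \<beta> / \<alpha>" using pos by (auto simp: r_def)
    have "0 \<le> (r * \<bar>a x\<bar> - \<bar>b x\<bar> / r)\<^sup>2" by simp
    also have "\<dots> = r\<^sup>2 * (a x)\<^sup>2 - 2 * \<bar>a x\<bar> * \<bar>b x\<bar> + (b x)\<^sup>2 / r\<^sup>2"
      using r(1) by (simp add: power2_diff power_mult_distrib power_divide)
    also have "\<dots> = \<beta> / \<alpha> * (a x)\<^sup>2 - 2 * \<bar>a x\<bar> * \<bar>b x\<bar> + \<alpha> / \<beta> * (b x)\<^sup>2"
      by (simp add: r(2))
    finally have *: "2 * \<bar>a x\<bar> * \<bar>b x\<bar> \<le> \<beta> / \<alpha> * (a x)\<^sup>2 + \<alpha> / \<beta> * (b x)\<^sup>2"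
      by simp
    have "(h x)\<^sup>2 \<le> (\<bar>a x\<bar> + \<bar>b x\<bar>)\<^sup>2"
      using h[OF \<open>x \<in> S\<close>] by (intro abs_le_square_iff[THEN iffD1]) simp
    also have "\<dots> = (a x)\<^sup>2 + 2 * \<bar>a x\<bar> * \<bar>b x\<bar> + (b x)\<^sup>2"
      by (simp add: power2_sum)
    finally show "(h x)\<^sup>2 \<le> (1 + \<beta> / \<alpha>) * (a x)\<^sup>2 + (1 + \<alpha> / \<beta>) * (b x)\<^sup>2"
      using * by (simp only: distrib_right mult_1_left)
    show "0 \<le> (1 + \<beta> / \<alpha>) * (a x)\<^sup>2 + (1 + \<alpha> / \<beta>) * (b x)\<^sup>2"
      using pos by (intro add_nonneg_nonneg mult_nonneg_nonneg) auto
  qed (intro set_integral_add set_integrable_mult_right a b)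
  also have "\<dots> = (1 + \<beta> / \<alpha>) * (LINT x:S|M. (a x)\<^sup>2) + (1 + \<alpha> / \<beta>) * (LINT x:S|M. (b x)\<^sup>2)"
    using a b by simp
  also have "\<dots> \<le> (1 + \<beta> / \<alpha>) * \<alpha>\<^sup>2 + (1 + \<alpha> / \<beta>) * \<beta>\<^sup>2"
    using pos by (intro add_mono mult_left_mono a b) auto
  also have "\<dots> = (\<alpha> + \<beta>)\<^sup>2"
    using pos by (simp add: power2_eq_square field_simps)
  finally show ?thesis .
qed

lemma step_graphon_cell:
  assumes "N \<ge> 1" "i \<in> {1..N}" "x \<in> cell N i"
  shows "step_graphon N M x y = (\<Sum>j\<in>{1..N}. M i j * indicator (cell N j) y)"
proof -
  have "step_graphon N M x y =
      (\<Sum>k\<in>{1..N}. if k = i then (\<Sum>j\<in>{1..N}. M i j * indicator (cell N j) y) else 0)"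
    unfolding step_graphon_def using assms cell_unique[OF assms(1), of _ i x]
    by (intro sum.cong refl) (auto simp: indicator_def)
  thus ?thesis using assms by simp
qed

lemma step_graphon_cells:
  assumes "N \<ge> 1" "i \<in> {1..N}" "x \<in> cell N i" "j \<in> {1..N}" "y \<in> cell N j"
  shows "step_graphon N M x y = M i j"
proof -
  have "step_graphon N M x y = (\<Sum>k\<in>{1..N}. if k = j then M i j else 0)"
    unfolding step_graphon_cell[OF assms(1-3)] using assms cell_unique[OF assms(1), of _ j y]
    by (intro sum.cong refl) (auto simp: indicator_def)
  thus ?thesis using assms by simp
qed

definition cell_mean :: "nat \<Rightarrow> (real \<Rightarrow> real) \<Rightarrow> nat \<Rightarrow> real" where
  "cell_mean N f j = real N * (LINT y:cell N j|lborel. f y)"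

lemma graphon_laplacian_step:
  assumes N: "N \<ge> 1" "i \<in> {1..N}" "x \<in> cell N i" and f: "set_integrable lborel {0..1} f"
  shows "set_integrable lborel {0..1} (\<lambda>y. step_graphon N M x y * (f x - f y))"
    and "graphon_laplacian (step_graphon N M) f x = (\<Sum>j\<in>{1..N}. M i j * (f x - cell_mean N f j)) / real N"
proof -
  have fc: "set_integrable lborel (cell N j) f" if "j \<in> {1..N}" for j
    using cell_subset[OF that] by (intro set_integrable_subset[OF f]) auto
  have int: "set_integrable lborel (cell N j) (\<lambda>y. M i j * (f x - f y))" if "j \<in> {1..N}" for j
    by (intro set_integrable_mult_right set_integral_diff set_integral_const_cell fc N that)
  have eq: "step_graphon N M x y * (f x - f y) = M i j * (f x - f y)" if "j \<in> {1..N}" "y \<in> cell N j" for j y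
    using step_graphon_cells[OF N that] by simp
  have int': "set_integrable lborel (cell N j) (\<lambda>y. step_graphon N M x y * (f x - f y))"
    if "j \<in> {1..N}" for j
    using int[OF that] eq[OF that] by (subst set_integrable_cong[OF refl refl]) auto
  show "set_integrable lborel {0..1} (\<lambda>y. step_graphon N M x y * (f x - f y))"
    by (rule set_integral_cells(1)[OF N(1) int'])
  have "graphon_laplacian (step_graphon N M) f x
      = (\<Sum>j\<in>{1..N}. LINT y:cell N j|lborel. step_graphon N M x y * (f x - f y))"
    unfolding graphon_laplacian_def by (rule set_integral_cells(2)[OF N(1) int'])
  also have "\<dots> = (\<Sum>j\<in>{1..N}. LINT y:cell N j|lborel. M i j * (f x - f y))"
    using eq by (intro sum.cong refl set_lebesgue_integral_cong) auto
  also have "\<dots> = (\<Sum>j\<in>{1..N}. M i j * (f x - cell_mean N f j) / real N)"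
  proof (intro sum.cong refl)
    fix j assume j: "j \<in> {1..N}"
    show "(LINT y:cell N j|lborel. M i j * (f x - f y)) = M i j * (f x - cell_mean N f j) / real N"
      using N(1) fc[OF j] by (simp add: set_integral_const_cell cell_mean_def field_simps)
  qed
  finally show "graphon_laplacian (step_graphon N M) f x
      = (\<Sum>j\<in>{1..N}. M i j * (f x - cell_mean N f j)) / real N"
    by (simp add: sum_divide_distrib)
qed

text \<open>On a cell the operator multiplies the fluctuation of \<open>f\<close> by the degree and acts on the
  cell means as a matrix Laplacian; the two parts are orthogonal in the square integral.\<close>

lemma step_laplacian_square_integral:
  assumes N: "N \<ge> 1" and f: "f \<in> L2_space"
    and deg: "\<And>i. i \<in> {1..N} \<Longrightarrow> \<bar>\<Sum>j\<in>{1..N}. M i j\<bar> \<le> C"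
    and lap: "\<And>v. (\<Sum>i\<in>{1..N}. (\<Sum>j\<in>{1..N}. M i j * (v i - v j))\<^sup>2) \<le> C\<^sup>2 * (\<Sum>i\<in>{1..N}. (v i)\<^sup>2)"
  shows "set_integrable lborel {0..1} (\<lambda>x. (graphon_laplacian (step_graphon N M) f x)\<^sup>2)"
    and "(LINT x:{0..1}|lborel. (graphon_laplacian (step_graphon N M) f x)\<^sup>2)
      \<le> (C / real N)\<^sup>2 * (LINT x:{0..1}|lborel. (f x)\<^sup>2)"
proof -
  let ?L = "graphon_laplacian (step_graphon N M) f"
  have f1: "set_integrable lborel {0..1} f" by (rule L2_space_integrable[OF f])
  have f2: "set_integrable lborel {0..1} (\<lambda>x. (f x)\<^sup>2)" using f by (simp add: L2_space_def)
  define m where "m = cell_mean N f"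
  define \<alpha> where "\<alpha> = (\<lambda>i. \<Sum>j\<in>{1..N}. M i j)"
  define y where "y = (\<lambda>i. \<Sum>j\<in>{1..N}. M i j * (m i - m j))"
  define S where "S = (\<lambda>i. LINT x:cell N i|lborel. (f x)\<^sup>2)"
  have c1: "set_integrable lborel (cell N i) f" and c2: "set_integrable lborel (cell N i) (\<lambda>x. (f x)\<^sup>2)"
    if "i \<in> {1..N}" for i
    using cell_subset[OF that] by (auto intro!: set_integrable_subset[OF f1] set_integrable_subset[OF f2])
  have Lx: "(?L x)\<^sup>2 = ((\<alpha> i)\<^sup>2 * (f x)\<^sup>2 + 2 * \<alpha> i * (y i - \<alpha> i * m i) * f x + (y i - \<alpha> i * m i)\<^sup>2) / (real N)\<^sup>2"
    if i: "i \<in> {1..N}" and x: "x \<in> cell N i" for i x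
  proof -
    have "?L x = (\<Sum>j\<in>{1..N}. M i j * f x + (M i j * (m i - m j) - M i j * m i)) / real N"
      unfolding graphon_laplacian_step(2)[OF N i x f1] m_def by (simp add: algebra_simps)
    also have "\<dots> = (\<alpha> i * f x + (y i - \<alpha> i * m i)) / real N"
      by (simp only: sum.distrib sum_subtractf \<alpha>_def y_def sum_distrib_right)
    finally show ?thesis
      by (simp add: power_divide power2_sum power_mult_distrib)
  qed
  have intc: "set_integrable lborel (cell N i)
      (\<lambda>x. ((\<alpha> i)\<^sup>2 * (f x)\<^sup>2 + 2 * \<alpha> i * (y i - \<alpha> i * m i) * f x + (y i - \<alpha> i * m i)\<^sup>2) / (real N)\<^sup>2)"
    if i: "i \<in> {1..N}" for i
    by (intro set_integrable_divide set_integral_add set_integrable_mult_right c1 c2 i set_integral_const_cell N)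
  have intL: "set_integrable lborel (cell N i) (\<lambda>x. (?L x)\<^sup>2)" if i: "i \<in> {1..N}" for i
    using intc[OF i] Lx[OF i] by (subst set_integrable_cong[OF refl refl]) auto
  show "set_integrable lborel {0..1} (\<lambda>x. (?L x)\<^sup>2)"
    by (rule set_integral_cells(1)[OF N intL])
  \<comment> \<open>On the cell the operator is \<open>\<alpha> i * (f x - m i) + y i\<close>,
    divided by \<open>N\<close>. The fluctuation has mean zero, so its mixed term with
    \<open>y i\<close> integrates to 0.\<close>
  have cellint: "(LINT x:cell N i|lborel. (?L x)\<^sup>2)
      = ((\<alpha> i)\<^sup>2 * (S i - (m i)\<^sup>2 / real N) + (y i)\<^sup>2 / real N) / (real N)\<^sup>2" if i: "i \<in> {1..N}" for i
  proof -
    have mi: "(LINT x:cell N i|lborel. f x) = m i / real N"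
      using N by (simp add: m_def cell_mean_def)
    have "(LINT x:cell N i|lborel. (?L x)\<^sup>2) = (LINT x:cell N i|lborel.
        ((\<alpha> i)\<^sup>2 * (f x)\<^sup>2 + 2 * \<alpha> i * (y i - \<alpha> i * m i) * f x + (y i - \<alpha> i * m i)\<^sup>2) / (real N)\<^sup>2)"
      using Lx[OF i] by (intro set_lebesgue_integral_cong) auto
    also have "\<dots> = ((\<alpha> i)\<^sup>2 * S i + 2 * \<alpha> i * (y i - \<alpha> i * m i) * (m i / real N)
        + (y i - \<alpha> i * m i)\<^sup>2 / real N) / (real N)\<^sup>2"
      using c1[OF i] c2[OF i] N by (simp add: set_integral_const_cell mi S_def)
    also have "2 * \<alpha> i * (y i - \<alpha> i * m i) * (m i / real N) + (y i - \<alpha> i * m i)\<^sup>2 / real N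
        = (y i)\<^sup>2 / real N - (\<alpha> i)\<^sup>2 * ((m i)\<^sup>2 / real N)"
      by (simp add: add_divide_distrib[symmetric] diff_divide_distrib[symmetric] power2_eq_square algebra_simps)
    hence "(\<alpha> i)\<^sup>2 * S i + 2 * \<alpha> i * (y i - \<alpha> i * m i) * (m i / real N) + (y i - \<alpha> i * m i)\<^sup>2 / real N
       = (\<alpha> i)\<^sup>2 * (S i - (m i)\<^sup>2 / real N) + (y i)\<^sup>2 / real N"
      by (simp only: add.assoc right_diff_distrib)
    finally show ?thesis .
  qed
  \<comment> \<open>This is the integral of the squared fluctuation; its sign is what permits
    replacing the squared degree by \<open>C^2\<close>.\<close>
  have var: "S i - (m i)\<^sup>2 / real N \<ge> 0" if i: "i \<in> {1..N}" for i
  proof -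
    have "0 \<le> (LINT x:cell N i|lborel. (f x - m i)\<^sup>2)"
      unfolding set_lebesgue_integral_def by (intro integral_nonneg_AE) auto
    also have "\<dots> = (LINT x:cell N i|lborel. (f x)\<^sup>2 - 2 * m i * f x + (m i)\<^sup>2)"
      by (simp add: power2_diff algebra_simps)
    also have "\<dots> = S i - 2 * m i * (m i / real N) + (m i)\<^sup>2 / real N"
      using c1[OF i] c2[OF i] N by (simp add: set_integral_const_cell S_def m_def cell_mean_def)
    finally show ?thesis by (simp add: power2_eq_square)
  qed
  have \<alpha>C: "(\<alpha> i)\<^sup>2 \<le> C\<^sup>2" if "i \<in> {1..N}" for i
    using deg[OF that] unfolding \<alpha>_def
    by (intro abs_le_square_iff[THEN iffD1]) simp
  have "(LINT x:{0..1}|lborel. (?L x)\<^sup>2)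
      = (\<Sum>i\<in>{1..N}. ((\<alpha> i)\<^sup>2 * (S i - (m i)\<^sup>2 / real N) + (y i)\<^sup>2 / real N) / (real N)\<^sup>2)"
    by (subst set_integral_cells(2)[OF N intL]) (auto intro!: sum.cong cellint)
  also have "\<dots> \<le> (\<Sum>i\<in>{1..N}. (C\<^sup>2 * (S i - (m i)\<^sup>2 / real N) + (y i)\<^sup>2 / real N) / (real N)\<^sup>2)"
    using var \<alpha>C by (intro sum_mono divide_right_mono add_right_mono mult_right_mono) auto
  also have "\<dots> = (C\<^sup>2 * (\<Sum>i\<in>{1..N}. S i) - C\<^sup>2 * (\<Sum>i\<in>{1..N}. (m i)\<^sup>2) / real N
      + (\<Sum>i\<in>{1..N}. (y i)\<^sup>2) / real N) / (real N)\<^sup>2"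
    by (simp add: sum.distrib sum_subtractf sum_distrib_left sum_divide_distrib[symmetric] right_diff_distrib)
  \<comment> \<open>The matrix bound, applied to the cell means, is absorbed by the negative term
    left over from the fluctuations, so degree and matrix parts share one constant.\<close>
  also have "\<dots> \<le> C\<^sup>2 * (\<Sum>i\<in>{1..N}. S i) / (real N)\<^sup>2"
  proof -
    have "(\<Sum>i\<in>{1..N}. (y i)\<^sup>2) / real N \<le> C\<^sup>2 * (\<Sum>i\<in>{1..N}. (m i)\<^sup>2) / real N"
      unfolding y_def by (intro divide_right_mono lap) simp
    thus ?thesis by (intro divide_right_mono) auto
  qed
  also have "(\<Sum>i\<in>{1..N}. S i) = (LINT x:{0..1}|lborel. (f x)\<^sup>2)"
    unfolding S_def using set_integral_cells(2)[OF N c2] by simp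
  finally show "(LINT x:{0..1}|lborel. (?L x)\<^sup>2) \<le> (C / real N)\<^sup>2 * (LINT x:{0..1}|lborel. (f x)\<^sup>2)"
    by (simp add: power_divide)
qed

section \<open>Comparison of a Lipschitz graphon with its samples\<close>

lemma lipschitz_continuous_section:
  assumes "K > 0" "lipschitz_A1 w K" "x \<in> {0..1}"
  shows "continuous_on {0..1} (w x)"
proof (rule continuous_onI)
  fix y e :: real assume y: "y \<in> {0..1}" and e: "0 < e"
  have "dist (w x y') (w x y) \<le> e" if "y' \<in> {0..1}" "dist y' y < e / K" for y'
  proof -
    have "\<bar>w x y' - w x y\<bar> \<le> K * (\<bar>x - x\<bar> + \<bar>y' - y\<bar>)"
      using assms that y unfolding lipschitz_A1_def by blast
    also have "\<dots> \<le> K * (e / K)" using assms that by (intro mult_left_mono) (auto simp: dist_real_def)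
    finally show ?thesis using assms by (simp add: dist_real_def)
  qed
  thus "\<exists>d>0. \<forall>y'\<in>{0..1}. dist y' y < d \<longrightarrow> dist (w x y') (w x y) \<le> e"
    using e assms(1) by (intro exI[of _ "e / K"]) auto
qed

lemma graphon_section_measurable:
  assumes "K > 0" "lipschitz_A1 w K" "x \<in> {0..1}"
  shows "set_borel_measurable lborel {0..1} (w x)"
  using borel_measurable_continuous_on_indicator[OF _ lipschitz_continuous_section[OF assms]]
  by (simp add: set_borel_measurable_def)

lemma graphon_laplacian_integrable:
  assumes w: "graphon w" "K > 0" "lipschitz_A1 w K" and x: "x \<in> {0..1}" and f: "f \<in> L2_space"
  shows "set_integrable lborel {0..1} (\<lambda>y. w x y * (f x - f y))"
proof (rule set_integrable_bound)
  show "set_integrable lborel {0..1} (\<lambda>y. \<bar>f x\<bar> + \<bar>f y\<bar>)"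
    by (intro set_integral_add set_integral_const_unit set_integrable_abs L2_space_integrable f)
  have [measurable]: "f \<in> borel_measurable borel" using f by (simp add: L2_space_def)
  have "(\<lambda>y. indicator {0..1} y *\<^sub>R w x y) \<in> borel_measurable lborel"
    using graphon_section_measurable[OF w(2,3) x] by (simp add: set_borel_measurable_def)
  hence "(\<lambda>y. (indicator {0..1} y *\<^sub>R w x y) * (f x - f y)) \<in> borel_measurable lborel"
    by measurable
  thus "set_borel_measurable lborel {0..1} (\<lambda>y. w x y * (f x - f y))"
    by (simp add: set_borel_measurable_def mult_ac)
  show "AE y in lborel. y \<in> {0..1} \<longrightarrow> norm (w x y * (f x - f y)) \<le> norm (\<bar>f x\<bar> + \<bar>f y\<bar>)"
  proof (intro AE_I2 impI)
    fix y :: real assume y: "y \<in> {0..1}"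
    have "0 \<le> w x y" "w x y \<le> 1" using w(1) x y by (auto simp: graphon_def)
    hence "\<bar>w x y\<bar> * \<bar>f x - f y\<bar> \<le> 1 * \<bar>f x - f y\<bar>"
      by (intro mult_right_mono) auto
    thus "norm (w x y * (f x - f y)) \<le> norm (\<bar>f x\<bar> + \<bar>f y\<bar>)"
      by (simp add: abs_mult)
  qed
qed

lemma d_max_le_1:
  assumes w: "graphon w" "K > 0" "lipschitz_A1 w K"
  shows "d_max w \<le> 1"
  unfolding d_max_def
proof (rule cSUP_least)
  fix x :: real assume x: "x \<in> {0..1}"
  have "degree w x \<le> (LINT y:{0..1::real}|lborel. 1)"
    unfolding degree_def using w x
    by (intro set_integral_mono_nonneg set_integral_const_unit) (auto simp: graphon_def)
  thus "degree w x \<le> 1" by (simp add: set_integral_const_unit)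
qed auto

text \<open>The sampling point is the right endpoint of its cell, so each of the two coordinates
  moves by at most \<open>1 / N\<close>.\<close>

lemma step_graphon_sample_close:
  assumes w: "K > 0" "lipschitz_A1 w K" and N: "N \<ge> 1" and x: "x \<in> {0..1}" and y: "y \<in> {0..1}"
  shows "\<bar>step_graphon N (sample_matrix w N) x y - w x y\<bar> \<le> 2 * K / real N"
proof -
  obtain i where i: "i \<in> {1..N}" "x \<in> cell N i" using obtain_cell[OF N x] .
  obtain j where j: "j \<in> {1..N}" "y \<in> cell N j" using obtain_cell[OF N y] .
  have near: "\<bar>real k / real N - z\<bar> \<le> 1 / real N" if "k \<in> {1..N}" "z \<in> cell N k" for k z
    using that N by (auto simp: cell_def diff_divide_distrib abs_le_iff split: if_splits)
  have unit: "real k / real N \<in> {0..1}" if "k \<in> {1..N}" for k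
    using that by auto
  have "\<bar>w (real i / real N) (real j / real N) - w x y\<bar>
      \<le> K * (\<bar>real i / real N - x\<bar> + \<bar>real j / real N - y\<bar>)"
    using w(2) x y unit[OF i(1)] unit[OF j(1)] unfolding lipschitz_A1_def by blast
  also have "\<dots> \<le> K * (1 / real N + 1 / real N)"
    using w(1) near[OF i] near[OF j] by (intro mult_left_mono add_mono) auto
  finally show ?thesis
    unfolding step_graphon_cells[OF N i j] sample_matrix_def by (simp add: mult.commute)
qed

lemma step_laplacian_pointwise_close:
  assumes w: "graphon w" "K > 0" "lipschitz_A1 w K" and N: "N \<ge> 1" and x: "x \<in> {0..1}"
    and f: "f \<in> L2_space" "(LINT x:{0..1}|lborel. (f x)\<^sup>2) \<le> 1"
  shows "\<bar>graphon_laplacian (step_graphon N (sample_matrix w N)) f x - graphon_laplacian w f x\<bar>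
    \<le> 2 * K / real N * (\<bar>f x\<bar> + 1)"
proof -
  let ?u = "step_graphon N (sample_matrix w N)"
  obtain i where i: "i \<in> {1..N}" "x \<in> cell N i" using obtain_cell[OF N x] .
  have int1: "set_integrable lborel {0..1} (\<lambda>y. ?u x y * (f x - f y))"
    by (rule graphon_laplacian_step(1)[OF N i L2_space_integrable[OF f(1)]])
  have int2: "set_integrable lborel {0..1} (\<lambda>y. w x y * (f x - f y))"
    by (rule graphon_laplacian_integrable[OF w x f(1)])
  have intf: "set_integrable lborel {0..1} (\<lambda>y. \<bar>f y\<bar>)"
    by (intro set_integrable_abs L2_space_integrable f)
  have intd: "set_integrable lborel {0..1} (\<lambda>y. (?u x y - w x y) * (f x - f y))"
    using set_integral_diff(1)[OF int1 int2] by (simp add: left_diff_distrib)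
  have "\<bar>graphon_laplacian ?u f x - graphon_laplacian w f x\<bar>
      = \<bar>LINT y:{0..1}|lborel. (?u x y - w x y) * (f x - f y)\<bar>"
    unfolding graphon_laplacian_def set_integral_diff(2)[OF int1 int2, symmetric]
    by (simp add: left_diff_distrib)
  also have "\<dots> \<le> (LINT y:{0..1}|lborel. \<bar>(?u x y - w x y) * (f x - f y)\<bar>)"
    using set_integral_norm_bound[OF intd] by simp
  also have "\<dots> \<le> (LINT y:{0..1}|lborel. 2 * K / real N * (\<bar>f x\<bar> + \<bar>f y\<bar>))"
  proof (intro set_integral_mono)
    fix y :: real assume y: "y \<in> {0..1}"
    show "\<bar>(?u x y - w x y) * (f x - f y)\<bar> \<le> 2 * K / real N * (\<bar>f x\<bar> + \<bar>f y\<bar>)"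
      unfolding abs_mult using step_graphon_sample_close[OF w(2,3) N x y] w(2)
      by (intro mult_mono) auto
  qed (intro set_integrable_abs intd set_integrable_mult_right set_integral_add set_integral_const_unit intf)+
  also have "\<dots> = 2 * K / real N * (\<bar>f x\<bar> + (LINT y:{0..1}|lborel. \<bar>f y\<bar>))"
    using intf set_integral_const_unit by simp
  also have "\<dots> \<le> 2 * K / real N * (\<bar>f x\<bar> + 1)"
    using w(2) L2_integral_abs_le[OF f] by (intro mult_left_mono) auto
  finally show ?thesis .
qed

text \<open>The squared norm of \<open>\<bar>f\<bar> + 1\<close> is at most
  \<open>1 + 2 + 1 = 4\<close>. This doubling turns the pointwise constant \<open>2 * K / N\<close>
  into \<open>4 * K / N\<close>.\<close>

lemma affine_majorant_square_integral:
  assumes f: "f \<in> L2_space" "(LINT x:{0..1}|lborel. (f x)\<^sup>2) \<le> 1"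
  shows "set_integrable lborel {0..1} (\<lambda>x. (c * (\<bar>f x\<bar> + 1))\<^sup>2)"
    and "(LINT x:{0..1}|lborel. (c * (\<bar>f x\<bar> + 1))\<^sup>2) \<le> (2 * c)\<^sup>2"
proof -
  have f2: "set_integrable lborel {0..1} (\<lambda>x. (f x)\<^sup>2)" using f by (simp add: L2_space_def)
  have f1: "set_integrable lborel {0..1} (\<lambda>x. \<bar>f x\<bar>)"
    by (intro set_integrable_abs L2_space_integrable f)
  have eq: "(c * (\<bar>f x\<bar> + 1))\<^sup>2 = c\<^sup>2 * ((f x)\<^sup>2 + 2 * \<bar>f x\<bar> + 1)" for x
    by (simp add: power_mult_distrib power2_sum)
  show "set_integrable lborel {0..1} (\<lambda>x. (c * (\<bar>f x\<bar> + 1))\<^sup>2)"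
    unfolding eq by (intro set_integrable_mult_right set_integral_add f1 f2 set_integral_const_unit)
  have "(LINT x:{0..1}|lborel. (c * (\<bar>f x\<bar> + 1))\<^sup>2)
      = c\<^sup>2 * ((LINT x:{0..1}|lborel. (f x)\<^sup>2) + 2 * (LINT x:{0..1}|lborel. \<bar>f x\<bar>) + 1)"
    unfolding eq using f1 f2 by (simp add: set_integral_const_unit)
  also have "\<dots> \<le> c\<^sup>2 * 4"
    using f(2) L2_integral_abs_le[OF f] by (intro mult_left_mono) auto
  finally show "(LINT x:{0..1}|lborel. (c * (\<bar>f x\<bar> + 1))\<^sup>2) \<le> (2 * c)\<^sup>2"
    by (simp add: power_mult_distrib)
qed

lemma op_norm_step_laplacian_diff_le:
  assumes w: "graphon w" "K > 0" "lipschitz_A1 w K" and N: "N \<ge> 1"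
  shows "op_norm (\<lambda>f x. graphon_laplacian (step_graphon N (sample_matrix w N)) f x
                        - graphon_laplacian w f x) \<le> ereal (4 * K / real N)"
proof (rule op_norm_le)
  show "0 \<le> 4 * K / real N" using w by simp
  fix f assume f: "f \<in> L2_space" "(LINT x:{0..1}|lborel. (f x)\<^sup>2) \<le> 1"
  let ?c = "2 * K / real N"
  have "(LINT x:{0..1}|lborel. (graphon_laplacian (step_graphon N (sample_matrix w N)) f x
        - graphon_laplacian w f x)\<^sup>2) \<le> (LINT x:{0..1}|lborel. (?c * (\<bar>f x\<bar> + 1))\<^sup>2)"
  proof (intro set_integral_mono_nonneg affine_majorant_square_integral f)
    fix x :: real assume x: "x \<in> {0..1}"
    show "(graphon_laplacian (step_graphon N (sample_matrix w N)) f x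
        - graphon_laplacian w f x)\<^sup>2 \<le> (?c * (\<bar>f x\<bar> + 1))\<^sup>2"
      by (intro abs_le_square_iff[THEN iffD1] order_trans[OF step_laplacian_pointwise_close[OF w N x f] abs_ge_self])
  qed auto
  also have "\<dots> \<le> (2 * ?c)\<^sup>2" by (rule affine_majorant_square_integral[OF f])
  finally show "(LINT x:{0..1}|lborel. (graphon_laplacian (step_graphon N (sample_matrix w N)) f x
        - graphon_laplacian w f x)\<^sup>2) \<le> (4 * K / real N)\<^sup>2" by simp
qed

text \<open>Inserting the Laplacian of the sampled step graphon splits the error into a step-graphon
  Laplacian with matrix \<open>(A - \<rho> P) / \<rho>\<close> and the deterministic discretisation
  error; the two norms add by Minkowski.\<close>

lemma op_norm_random_laplacian_diff_le:
  assumes w: "graphon w" "K > 0" "lipschitz_A1 w K" and N: "N \<ge> 1" and \<rho>: "\<rho> > 0" and C: "C > 0"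
    and deg: "\<And>i. i \<in> {1..N} \<Longrightarrow> \<bar>\<Sum>j\<in>{1..N}. A i j - \<rho> * sample_matrix w N i j\<bar> \<le> C"
    and lap: "\<And>v. (\<Sum>i\<in>{1..N}. (\<Sum>j\<in>{1..N}. (A i j - \<rho> * sample_matrix w N i j) * (v i - v j))\<^sup>2)
        \<le> C\<^sup>2 * (\<Sum>i\<in>{1..N}. (v i)\<^sup>2)"
  shows "op_norm (\<lambda>f x. graphon_laplacian (step_graphon N A) f x / \<rho> - graphon_laplacian w f x)
    \<le> ereal (C / (\<rho> * real N) + 4 * K / real N)"
proof (rule op_norm_le)
  show "0 \<le> C / (\<rho> * real N) + 4 * K / real N" using w \<rho> C by simp
  fix f assume f: "f \<in> L2_space" "(LINT x:{0..1}|lborel. (f x)\<^sup>2) \<le> 1"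
  define P where "P = sample_matrix w N"
  define M where "M = (\<lambda>i j. (A i j - \<rho> * P i j) / \<rho>)"
  let ?c = "2 * K / real N"
  have degM: "\<bar>\<Sum>j\<in>{1..N}. M i j\<bar> \<le> C / \<rho>" if "i \<in> {1..N}" for i
    using deg[OF that] \<rho> unfolding M_def P_def
    by (simp add: sum_divide_distrib[symmetric] divide_right_mono)
  have lapM: "(\<Sum>i\<in>{1..N}. (\<Sum>j\<in>{1..N}. M i j * (v i - v j))\<^sup>2) \<le> (C / \<rho>)\<^sup>2 * (\<Sum>i\<in>{1..N}. (v i)\<^sup>2)" for v
  proof -
    have "(\<Sum>j\<in>{1..N}. M i j * (v i - v j)) = (\<Sum>j\<in>{1..N}. (A i j - \<rho> * P i j) * (v i - v j)) / \<rho>" for i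
      by (simp add: M_def sum_divide_distrib)
    hence "(\<Sum>i\<in>{1..N}. (\<Sum>j\<in>{1..N}. M i j * (v i - v j))\<^sup>2)
        = (\<Sum>i\<in>{1..N}. (\<Sum>j\<in>{1..N}. (A i j - \<rho> * P i j) * (v i - v j))\<^sup>2) / \<rho>\<^sup>2"
      by (simp only: power_divide sum_divide_distrib[symmetric])
    also have "\<dots> \<le> C\<^sup>2 * (\<Sum>i\<in>{1..N}. (v i)\<^sup>2) / \<rho>\<^sup>2"
      unfolding P_def by (intro divide_right_mono lap) simp
    finally show ?thesis by (simp add: power_divide)
  qed
  note sq = step_laplacian_square_integral[OF N f(1) degM lapM]
  have "(LINT x:{0..1}|lborel. (graphon_laplacian (step_graphon N M) f x)\<^sup>2)
      \<le> (C / \<rho> / real N)\<^sup>2 * (LINT x:{0..1}|lborel. (f x)\<^sup>2)" by (rule sq(2))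
  also have "\<dots> \<le> (C / \<rho> / real N)\<^sup>2 * 1" using f(2) by (intro mult_left_mono) auto
  finally have sq2: "(LINT x:{0..1}|lborel. (graphon_laplacian (step_graphon N M) f x)\<^sup>2)
      \<le> (C / (\<rho> * real N))\<^sup>2" by simp
  have "(LINT x:{0..1}|lborel. (graphon_laplacian (step_graphon N A) f x / \<rho> - graphon_laplacian w f x)\<^sup>2)
      \<le> (C / (\<rho> * real N) + 2 * ?c)\<^sup>2"
  proof (rule minkowski_square_le[OF sq(1) sq2 affine_majorant_square_integral[OF f]])
    show "0 < C / (\<rho> * real N)" "0 < 2 * ?c" using C \<rho> N w by auto
    fix x :: real assume x: "x \<in> {0..1}"
    obtain i where i: "i \<in> {1..N}" "x \<in> cell N i" using obtain_cell[OF N x] .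
    note st = graphon_laplacian_step(2)[OF N i L2_space_integrable[OF f(1)]]
    have "graphon_laplacian (step_graphon N M) f x
        = graphon_laplacian (step_graphon N A) f x / \<rho> - graphon_laplacian (step_graphon N P) f x"
    proof -
      have "M i j * z = A i j * z / \<rho> - P i j * z" for j z
        using \<rho> by (simp add: M_def field_simps)
      thus ?thesis unfolding st
        by (simp add: sum_subtractf diff_divide_distrib sum_divide_distrib[symmetric])
    qed
    moreover have "\<bar>graphon_laplacian (step_graphon N P) f x - graphon_laplacian w f x\<bar> \<le> \<bar>?c * (\<bar>f x\<bar> + 1)\<bar>"
      unfolding P_def by (rule order_trans[OF step_laplacian_pointwise_close[OF w N x f] abs_ge_self])
    ultimately show "\<bar>graphon_laplacian (step_graphon N A) f x / \<rho> - graphon_laplacian w f x\<bar>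
        \<le> \<bar>graphon_laplacian (step_graphon N M) f x\<bar> + \<bar>?c * (\<bar>f x\<bar> + 1)\<bar>"
      by linarith
  qed
  thus "(LINT x:{0..1}|lborel. (graphon_laplacian (step_graphon N A) f x / \<rho> - graphon_laplacian w f x)\<^sup>2)
      \<le> (C / (\<rho> * real N) + 4 * K / real N)\<^sup>2" by simp
qed

section \<open>The random graph Laplacian\<close>

lemma sum_edge_slots:
  "(\<Sum>e\<in>edge_slots N. f e) = (\<Sum>i\<in>{1..N}. \<Sum>j\<in>{1..N}. if i < j then f (i, j) else (0::real))"
proof -
  have "edge_slots N = {e \<in> {1..N} \<times> {1..N}. fst e < snd e}"
    by (auto simp: edge_slots_def)
  hence "(\<Sum>e\<in>edge_slots N. f e) = (\<Sum>e\<in>{1..N} \<times> {1..N}. if fst e < snd e then f e else 0)"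
    by (simp add: sum.inter_filter)
  also have "\<dots> = (\<Sum>i\<in>{1..N}. \<Sum>j\<in>{1..N}. if i < j then f (i, j) else 0)"
    unfolding sum.cartesian_product by (intro sum.cong refl) auto
  finally show ?thesis .
qed

lemma finite_edge_slots: "finite (edge_slots N)"
  by (rule finite_subset[of _ "{1..N} \<times> {1..N}"]) (auto simp: edge_slots_def)

definition edge_vec :: "nat \<times> nat \<Rightarrow> nat \<Rightarrow> real" where
  "edge_vec e k = of_bool (k = fst e) - of_bool (k = snd e)"

lemma ip_edge_vec:
  assumes "i \<in> {1..N}" "j \<in> {1..N}"
  shows "ip {1..N} x (edge_vec (i, j)) = x i - x j"
proof -
  have "ip {1..N} x (edge_vec (i, j))
      = (\<Sum>k\<in>{1..N}. (if k = i then x i else 0) - (if k = j then x j else 0))"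
    unfolding ip_def edge_vec_def by (intro sum.cong refl) auto
  thus ?thesis using assms by (simp add: sum_subtractf)
qed

text \<open>Each squared difference is at most twice the sum of the squares, and a vertex lies on
  \<open>N - 1\<close> potential edges. Keeping \<open>N - 1\<close> rather than \<open>N\<close>
  leaves the slack used later for the diagonal.\<close>

lemma complete_graph_laplacian_le:
  assumes "\<rho> \<ge> 0" "\<And>e. e \<in> edge_slots N \<Longrightarrow> p e \<le> \<rho>"
  shows "(\<Sum>e\<in>edge_slots N. p e * (ip {1..N} x (edge_vec e))\<^sup>2) \<le> 2 * \<rho> * (real N - 1) * ip {1..N} x x"
proof -
  let ?I = "{1..N}"
  have "(\<Sum>e\<in>edge_slots N. p e * (ip ?I x (edge_vec e))\<^sup>2)
      \<le> (\<Sum>e\<in>edge_slots N. \<rho> * (2 * ((x (fst e))\<^sup>2 + (x (snd e))\<^sup>2)))"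
  proof (intro sum_mono mult_mono assms)
    fix e assume e: "e \<in> edge_slots N"
    have "ip ?I x (edge_vec e) = x (fst e) - x (snd e)"
      using e ip_edge_vec[of "fst e" N "snd e" x] by (auto simp: edge_slots_def)
    thus "(ip ?I x (edge_vec e))\<^sup>2 \<le> 2 * ((x (fst e))\<^sup>2 + (x (snd e))\<^sup>2)"
      using zero_le_power2[of "x (fst e) + x (snd e)"] by (simp add: power2_sum power2_diff)
  qed auto
  also have "\<dots> = 2 * \<rho> * (\<Sum>i\<in>?I. \<Sum>j\<in>?I. (if i < j then (x i)\<^sup>2 else 0) + (if i < j then (x j)\<^sup>2 else 0))"
    unfolding sum_edge_slots sum_distrib_left by (intro sum.cong refl) auto
  \<comment> \<open>Exchanging the summation order in the second part makes both parts carry the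
    square at \<open>i\<close>; together they run over all \<open>j\<close> different from
    \<open>i\<close>.\<close>
  also have "(\<Sum>i\<in>?I. \<Sum>j\<in>?I. (if i < j then (x i)\<^sup>2 else 0) + (if i < j then (x j)\<^sup>2 else 0))
      = (\<Sum>i\<in>?I. \<Sum>j\<in>?I. if i < j then (x i)\<^sup>2 else 0) + (\<Sum>i\<in>?I. \<Sum>j\<in>?I. if j < i then (x i)\<^sup>2 else 0)"
    unfolding sum.distrib by (subst (2) sum.swap) simp
  also have "\<dots> = (\<Sum>i\<in>?I. \<Sum>j\<in>?I. (x i)\<^sup>2 - (if j = i then (x i)\<^sup>2 else 0))"
    unfolding sum.distrib[symmetric] by (intro sum.cong refl) auto
  also have "\<dots> = (\<Sum>i\<in>?I. (real N - 1) * (x i)\<^sup>2)"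
    by (intro sum.cong refl) (simp add: sum_subtractf algebra_simps)
  also have "\<dots> = (real N - 1) * ip ?I x x"
    by (simp add: ip_def sum_distrib_left power2_eq_square)
  finally show ?thesis by (simp only: mult.assoc)
qed

text \<open>Only edges at \<open>i\<close> contribute to row \<open>i\<close>. If \<open>i\<close>
  is the larger endpoint, both \<open>edge_vec e i\<close> and the difference of \<open>v\<close>
  change sign, so the orientation drops out.\<close>

lemma edge_sum_laplacian:
  assumes i: "i \<in> {1..N}"
  shows "(\<Sum>e\<in>edge_slots N. m e * edge_vec e i * ip {1..N} v (edge_vec e))
    = (\<Sum>j\<in>{1..N}. (if i < j then m (i, j) else if j < i then m (j, i) else 0) * (v i - v j))"
proof -
  let ?I = "{1..N}"
  have "(\<Sum>e\<in>edge_slots N. m e * edge_vec e i * ip ?I v (edge_vec e))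
      = (\<Sum>a\<in>?I. \<Sum>c\<in>?I. (if a = i then (if i < c then m (i, c) * (v i - v c) else 0) else 0)
          + (if c = i then (if a < i then m (a, i) * (v i - v a) else 0) else 0))"
    unfolding sum_edge_slots by (intro sum.cong refl) (use i in \<open>auto simp: ip_edge_vec[simplified] edge_vec_def algebra_simps\<close>)
  also have "\<dots> = (\<Sum>c\<in>?I. if i < c then m (i, c) * (v i - v c) else 0)
      + (\<Sum>a\<in>?I. if a < i then m (a, i) * (v i - v a) else 0)"
  proof -
    have "(\<Sum>a\<in>?I. \<Sum>c\<in>?I. if a = i then (if i < c then m (i, c) * (v i - v c) else 0) else 0)
        = (\<Sum>c\<in>?I. if i < c then m (i, c) * (v i - v c) else 0)"
      using i by (subst sum.swap) simp
    thus ?thesis unfolding sum.distrib using i by simp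
  qed
  also have "\<dots> = (\<Sum>j\<in>?I. (if i < j then m (i, j) else if j < i then m (j, i) else 0) * (v i - v j))"
    unfolding sum.distrib[symmetric] by (intro sum.cong refl) auto
  finally show ?thesis .
qed

section \<open>Scalar Bernstein estimates\<close>

text \<open>Bernstein's bound with the denominator \<open>1 - x / 3\<close> cleared, so that it also
  makes sense for \<open>x \<ge> 3\<close>. The difference of the sides and its first derivative
  vanish at 0, and the second derivative is nonnegative because
  \<open>1 - z \<le> exp (- z)\<close>.\<close>

lemma exp_minus_affine_le:
  fixes x :: real
  assumes "0 \<le> x"
  shows "(exp x - 1 - x) * (1 - x / 3) \<le> x\<^sup>2 / 2"
proof -
  define g where "g = (\<lambda>x::real. x\<^sup>2 / 2 - (exp x - 1 - x) * (1 - x / 3))"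
  define g' where "g' = (\<lambda>x::real. x - (exp x - 1) * (1 - x / 3) + (exp x - 1 - x) / 3)"
  have g': "(g has_real_derivative g' y) (at y)" for y
    unfolding g_def g'_def by (auto intro!: derivative_eq_intros simp: field_simps)
  have g'': "(g' has_real_derivative (1 - exp y * (1 - y)) / 3) (at y)" for y
    unfolding g'_def by (auto intro!: derivative_eq_intros simp: field_simps)
  have g'_nonneg: "g' y \<ge> 0" if "y \<ge> 0" for y
  proof -
    have "g' 0 \<le> g' y"
    proof (rule DERIV_nonneg_imp_nondecreasing[OF that])
      fix z :: real assume "0 \<le> z"
      have "exp z * (1 - z) \<le> exp z * exp (- z)"
        using exp_ge_add_one_self[of "-z"] by (intro mult_left_mono) auto
      hence "0 \<le> (1 - exp z * (1 - z)) / 3" by (simp add: exp_minus)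
      with g'' show "\<exists>d. (g' has_real_derivative d) (at z) \<and> 0 \<le> d" by blast
    qed
    thus ?thesis by (simp add: g'_def)
  qed
  have "g 0 \<le> g x"
    using g' g'_nonneg by (intro DERIV_nonneg_imp_nondecreasing[OF assms]) blast
  thus ?thesis by (simp add: g_def)
qed

text \<open>With \<open>r = sqrt (\<Lambda> / s)\<close> the choice \<open>T = r / (1 + 2 r / 3)\<close> is the usual one in
  Bernstein's inequality for variance proxy \<open>4 s\<close> and summands bounded by \<open>2\<close>.\<close>

lemma bernstein_exponent:
  fixes s \<Lambda> :: real
  assumes s: "s > 0" and \<Lambda>: "\<Lambda> \<ge> 0" "4 * \<Lambda> \<le> 9 * s"
  obtains T where "T \<ge> 0" "s * (exp (2 * T) - 1 - 2 * T) - T * (4 * sqrt (s * \<Lambda>)) \<le> - \<Lambda>"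
proof -
  define r where "r = sqrt (\<Lambda> / s)"
  have r0: "r \<ge> 0" and r2: "r\<^sup>2 = \<Lambda> / s" using s \<Lambda> by (auto simp: r_def)
  \<comment> \<open>The condition \<open>4 * \<Lambda> \<le> 9 * s\<close> is used here: it says
    \<open>r \<le> 3 / 2\<close>, equivalently \<open>q \<le> 2\<close> below.\<close>
  have "r\<^sup>2 \<le> (3/2)\<^sup>2" unfolding r2 using s \<Lambda> by (simp add: field_simps power2_eq_square)
  hence r32: "r \<le> 3/2" by (rule power2_le_imp_le) simp
  have sr: "sqrt (s * \<Lambda>) = s * r"
  proof -
    have "(s * r)\<^sup>2 = s\<^sup>2 * (\<Lambda> / s)" by (simp only: power_mult_distrib r2)
    hence "s * \<Lambda> = (s * r)\<^sup>2" using s by (simp add: power2_eq_square)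
    thus ?thesis using s r0 by simp
  qed
  define q where "q = 1 + 2 * r / 3"
  have q: "q > 0" "q \<le> 2" using r0 r32 by (auto simp: q_def)
  define T where "T = r / q"
  have T0: "T \<ge> 0" using r0 q by (simp add: T_def)
  \<comment> \<open>With this \<open>T\<close> the Bernstein denominator becomes
    \<open>1 / q\<close>, so the bound on the exponential is explicit in \<open>r\<close> and
    \<open>q\<close>.\<close>
  have "1 - 2 * T / 3 = (q - 2 * r / 3) / q"
    using q(1) by (simp add: T_def diff_divide_distrib)
  also have "q - 2 * r / 3 = 1" by (simp add: q_def)
  finally have "1 - 2 * T / 3 = 1 / q" .
  hence "(exp (2 * T) - 1 - 2 * T) / q \<le> 2 * T\<^sup>2"
    using exp_minus_affine_le[of "2 * T"] T0 by (simp add: power_mult_distrib)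
  hence "exp (2 * T) - 1 - 2 * T \<le> 2 * T\<^sup>2 * q"
    using q by (simp add: field_simps)
  also have "\<dots> = 2 * (r\<^sup>2 / q)"
    using q by (simp add: T_def power2_eq_square)
  finally have "exp (2 * T) - 1 - 2 * T - 4 * T * r \<le> 2 * (r\<^sup>2 / q) - 4 * (r\<^sup>2 / q)"
    by (simp add: T_def power2_eq_square)
  \<comment> \<open>The left side is \<open>- 2 * r^2 / q\<close>, and \<open>q \<le> 2\<close>
    finishes.\<close>
  also have "\<dots> \<le> - r\<^sup>2"
    using q mult_left_mono[of q 2 "r\<^sup>2"] by (simp add: field_simps)
  finally have "s * (exp (2 * T) - 1 - 2 * T - 4 * T * r) \<le> s * (- r\<^sup>2)"
    using s by (intro mult_left_mono) auto
  also have "\<dots> = - \<Lambda>" using s by (simp add: r2)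
  finally show ?thesis
    using T0 by (intro that[of T]) (simp_all only: sr, simp add: algebra_simps)
qed

text \<open>On the event that the quadratic form of the centred Laplacian is bounded at level
  \<open>t - \<rho>\<close>, the degree bound and the matrix bound both hold at level
  \<open>t\<close>. Dividing \<open>t\<close> by \<open>\<rho> * N\<close> produces the square-root
  term.\<close>

lemma prob_random_laplacian_diff_ge:
  assumes w: "graphon w" "K > 0" "lipschitz_A1 w K" and N: "N \<ge> 1"
    and \<rho>: "0 < \<rho>" "\<rho> \<le> 1" and \<epsilon>: "0 < \<epsilon>" "\<epsilon> \<le> 1"
    and thr: "4 * ln (4 * real N / \<epsilon>) \<le> 9 * (\<rho> * real N)"
  shows "measure_pmf.prob (random_graph w \<rho> N)
      {X. op_norm (\<lambda>f x. graphon_laplacian (step_graphon N (adj_matrix X)) f x / \<rho>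
                         - graphon_laplacian w f x)
          \<le> ereal (4 * sqrt (ln (4 * real N / \<epsilon>) / (\<rho> * real N)) + 4 * K / real N)}
    \<ge> 1 - \<epsilon>" (is "measure_pmf.prob _ ?good \<ge> _")
proof -
  define I where "I = {1..N}"
  define s where "s = \<rho> * real N"
  define \<Lambda> where "\<Lambda> = ln (4 * real N / \<epsilon>)"
  define p where "p = (\<lambda>e. \<rho> * w (real (fst e) / real N) (real (snd e) / real N))"
  define t where "t = 4 * sqrt (s * \<Lambda>)"
  have s: "s > 0" using \<rho> N by (simp add: s_def)
  have "4 * real N / \<epsilon> > 1" using N \<epsilon> by (simp add: field_simps)
  hence \<Lambda>: "\<Lambda> > 0" by (simp add: \<Lambda>_def)
  have t: "t > 0" using s \<Lambda> by (simp add: t_def)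
  have unit: "real k / real N \<in> {0..1}" if "k \<in> {1..N}" for k using that by auto
  have w01: "0 \<le> w (real i / real N) (real j / real N) \<and> w (real i / real N) (real j / real N) \<le> 1"
    if "i \<in> {1..N}" "j \<in> {1..N}" for i j
    using w(1) unit[OF that(1)] unit[OF that(2)] unfolding graphon_def by blast
  have p: "0 \<le> p e \<and> p e \<le> \<rho>" if "e \<in> edge_slots N" for e
    using that w01[of "fst e" "snd e"] \<rho> by (auto simp: edge_slots_def p_def mult_left_le)
  interpret bernoulli_rank_one_sum I "edge_slots N" edge_vec p 2 "2 * \<rho> * (real N - 1)"
  proof
    show "finite I" "finite (edge_slots N)" by (simp_all add: I_def finite_edge_slots)
    show "0 \<le> p e \<and> p e \<le> 1" if "e \<in> edge_slots N" for e
      using p[OF that] \<rho> by auto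
    show "ip I (edge_vec e) (edge_vec e) = 2" if "e \<in> edge_slots N" for e
    proof -
      obtain i j where "e = (i, j)" "i \<in> {1..N}" "j \<in> {1..N}" "i \<noteq> j"
        using \<open>e \<in> edge_slots N\<close> by (auto simp: edge_slots_def)
      thus ?thesis by (simp add: I_def ip_edge_vec[simplified]) (simp add: edge_vec_def)
    qed
    show "(\<Sum>e\<in>edge_slots N. p e * (ip I x (edge_vec e))\<^sup>2) \<le> 2 * \<rho> * (real N - 1) * ip I x x" for x
      unfolding I_def using \<rho> p by (intro complete_graph_laplacian_le) auto
  qed (use \<rho> N in auto)
  have law_eq: "random_graph w \<rho> N = law"
    by (simp add: random_graph_def p_def case_prod_unfold)
  obtain T where T: "T \<ge> 0" "s * (exp (2 * T) - 1 - 2 * T) - T * t \<le> - \<Lambda>"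
    using bernstein_exponent[OF s, of \<Lambda>] \<Lambda> thr unfolding t_def \<Lambda>_def s_def by (metis less_imp_le)
  let ?G = "{X. \<forall>x. \<bar>ip I x (mv I (cmat 1 X) x)\<bar> \<le> (t - \<rho>) * ip I x x}"
  have tail: "2 * real (card I) * exp (2 * \<rho> * (real N - 1) * ((exp (2 * T) - 1) / 2 - T) - T * (t - \<rho>)) \<le> \<epsilon>"
  proof -
    define h where "h = exp (2 * T) - 1 - 2 * T"
    \<comment> \<open>Lowering the level costs \<open>\<rho> * T\<close> in the exponent, while
      having \<open>N - 1\<close> instead of \<open>N\<close> gains \<open>\<rho> * h\<close>. As
      \<open>h \<ge> 2 * T^2\<close>, the net cost is at most \<open>\<rho> / 8\<close>, the maximum
      of \<open>T - 2 * T^2\<close> being at \<open>T = 1 / 4\<close>.\<close>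
    have "2 * T\<^sup>2 \<le> h"
      using exp_lower_Taylor_quadratic[of "2 * T"] T(1) by (simp add: h_def power_mult_distrib)
    moreover have "T - 2 * T\<^sup>2 \<le> 1/8"
      using zero_le_power2[of "T - 1/4"] by (simp add: power2_diff power2_eq_square algebra_simps)
    ultimately have "\<rho> * (T - h) \<le> \<rho> * (1/8)"
      using \<rho> by (intro mult_left_mono) auto
    hence "\<rho> * (T - h) \<le> 1/2" using \<rho> by linarith
    moreover have "2 * \<rho> * (real N - 1) * ((exp (2 * T) - 1) / 2 - T) - T * (t - \<rho>)
        = s * h - T * t + \<rho> * (T - h)"
      by (simp add: h_def s_def field_simps)
    ultimately have "2 * \<rho> * (real N - 1) * ((exp (2 * T) - 1) / 2 - T) - T * (t - \<rho>) \<le> - \<Lambda> + 1/2"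
      using T(2) by (simp add: h_def)
    hence "exp (2 * \<rho> * (real N - 1) * ((exp (2 * T) - 1) / 2 - T) - T * (t - \<rho>)) \<le> exp (- \<Lambda> + 1/2)"
      by simp
    also have "\<dots> = exp (- \<Lambda>) * exp (1/2)" by (rule exp_add)
    \<comment> \<open>The net cost spends the spare factor 2:
      \<open>2 * N * exp (- \<Lambda>)\<close> is only \<open>\<epsilon> / 2\<close>.\<close>
    also have "\<dots> \<le> exp (- \<Lambda>) * 2" using exp_half_le2 by (intro mult_left_mono) auto
    also have "exp (- \<Lambda>) = \<epsilon> / (4 * real N)"
      using N \<epsilon> by (simp add: \<Lambda>_def exp_minus)
    finally have "2 * real N * exp (2 * \<rho> * (real N - 1) * ((exp (2 * T) - 1) / 2 - T) - T * (t - \<rho>))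
        \<le> 2 * real N * (\<epsilon> / (4 * real N) * 2)"
      by (intro mult_left_mono) auto
    thus ?thesis using N by (simp add: I_def)
  qed
  have "?G \<subseteq> ?good"
  proof
    fix X assume "X \<in> ?G"
    hence G: "\<bar>ip I x (mv I (cmat 1 X) x)\<bar> \<le> (t - \<rho>) * ip I x x" for x by simp
    define M where "M = (\<lambda>i j. adj_matrix X i j - \<rho> * sample_matrix w N i j)"
    \<comment> \<open>Diagonal entries of \<open>M\<close> are multiplied by
      \<open>v i - v i = 0\<close>, so the edge sum, which has no loops, represents the full matrix
      Laplacian.\<close>
    have mv_eq: "mv I (cmat 1 X) v i = (\<Sum>j\<in>{1..N}. M i j * (v i - v j))" if i: "i \<in> {1..N}" for v i
    proof -
      have "mv I (cmat 1 X) v i = (\<Sum>e\<in>edge_slots N. (of_bool (X e) - p e) * edge_vec e i * ip I v (edge_vec e))"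
        unfolding mv_def cmat_def ip_def sum_distrib_left sum_distrib_right
        by (subst sum.swap) (simp add: mult_ac)
      also have "\<dots> = (\<Sum>j\<in>{1..N}. (if i < j then of_bool (X (i, j)) - p (i, j)
          else if j < i then of_bool (X (j, i)) - p (j, i) else 0) * (v i - v j))"
        unfolding I_def by (rule edge_sum_laplacian[OF i])
      also have "\<dots> = (\<Sum>j\<in>{1..N}. M i j * (v i - v j))"
      proof (intro sum.cong refl)
        fix j assume j: "j \<in> {1..N}"
        have "w (real i / real N) (real j / real N) = w (real j / real N) (real i / real N)"
          using w(1) unit[OF i] unit[OF j] unfolding graphon_def by blast
        thus "(if i < j then of_bool (X (i, j)) - p (i, j)
          else if j < i then of_bool (X (j, i)) - p (j, i) else 0) * (v i - v j) = M i j * (v i - v j)"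
          by (cases i j rule: linorder_cases) (auto simp: M_def adj_matrix_def p_def sample_matrix_def)
      qed
      finally show ?thesis .
    qed
    define \<delta> where "\<delta> = (\<lambda>i k::nat. of_bool (k = i) :: real)"
    have ip_\<delta>: "ip I (\<delta> i) x = x i" if "i \<in> {1..N}" for i x
      using that by (simp add: ip_def \<delta>_def I_def of_bool_def if_distrib[of "\<lambda>x. x * _"] cong: if_cong)
    \<comment> \<open>Off-diagonal row sums are the diagonal entries of the Laplacian, hence
      controlled by testing the quadratic form on a unit vector.\<close>
    have D: "\<bar>\<Sum>j\<in>{1..N}. M i j * (1 - \<delta> i j)\<bar> \<le> t - \<rho>" if i: "i \<in> {1..N}" for i
    proof -
      have "ip I (\<delta> i) (mv I (cmat 1 X) (\<delta> i)) = (\<Sum>j\<in>{1..N}. M i j * (1 - \<delta> i j))"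
        unfolding ip_\<delta>[OF i] mv_eq[OF i] by (simp add: \<delta>_def)
      thus ?thesis using G[of "\<delta> i"] by (simp add: ip_\<delta>[OF i]) (simp add: \<delta>_def)
    qed
    have deg: "\<bar>\<Sum>j\<in>{1..N}. M i j\<bar> \<le> t" if i: "i \<in> {1..N}" for i
    proof -
      have "(\<Sum>j\<in>{1..N}. M i j) = (\<Sum>j\<in>{1..N}. M i j * (1 - \<delta> i j) + (if j = i then M i i else 0))"
        by (intro sum.cong refl) (auto simp: \<delta>_def)
      also have "\<dots> = (\<Sum>j\<in>{1..N}. M i j * (1 - \<delta> i j)) + M i i"
        using i by (simp add: sum.distrib)
      finally have eq: "(\<Sum>j\<in>{1..N}. M i j) = (\<Sum>j\<in>{1..N}. M i j * (1 - \<delta> i j)) + M i i" .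
      \<comment> \<open>The adjacency matrix has zero diagonal while the samples need not, so the
        degree changes by at most \<open>\<rho>\<close>; this raises the level from
        \<open>t - \<rho>\<close> to \<open>t\<close>.\<close>
      have "\<bar>M i i\<bar> \<le> \<rho>"
        using w01[OF i i] \<rho> by (simp add: M_def adj_matrix_def sample_matrix_def abs_mult mult_left_le)
      with D[OF i] show ?thesis unfolding eq by linarith
    qed
    \<comment> \<open>On this event \<open>t - \<rho>\<close> dominates an absolute value, so its
      sign comes for free; it is needed to compare the squares of \<open>t - \<rho>\<close> and
      \<open>t\<close>.\<close>
    have t\<rho>: "t - \<rho> \<ge> 0"
      using D[of 1] N by (meson abs_ge_zero atLeastAtMost_iff order_refl order_trans)
    have lap: "(\<Sum>i\<in>{1..N}. (\<Sum>j\<in>{1..N}. M i j * (v i - v j))\<^sup>2) \<le> t\<^sup>2 * (\<Sum>i\<in>{1..N}. (v i)\<^sup>2)" for v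
    proof -
      have "(\<Sum>i\<in>{1..N}. (\<Sum>j\<in>{1..N}. M i j * (v i - v j))\<^sup>2) = ip I (mv I (cmat 1 X) v) (mv I (cmat 1 X) v)"
        unfolding ip_def I_def[symmetric] power2_eq_square
        using mv_eq unfolding I_def[symmetric] by (intro sum.cong refl) simp
      also have "\<dots> \<le> (t - \<rho>)\<^sup>2 * ip I v v"
        by (rule symmetric_norm_bound[OF finite_I symmetric_cmat G])
      also have "\<dots> \<le> t\<^sup>2 * ip I v v"
        using t\<rho> \<rho> by (intro mult_right_mono power_mono ip_self_nonneg) auto
      finally show ?thesis by (simp add: ip_def I_def power2_eq_square)
    qed
    have "op_norm (\<lambda>f x. graphon_laplacian (step_graphon N (adj_matrix X)) f x / \<rho> - graphon_laplacian w f x)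
      \<le> ereal (t / (\<rho> * real N) + 4 * K / real N)"
      using deg lap unfolding M_def by (intro op_norm_random_laplacian_diff_le w N \<rho> t)
    also have "t / (\<rho> * real N) = 4 * sqrt (\<Lambda> / s)"
    proof -
      have "sqrt (s * \<Lambda>) = s * sqrt (\<Lambda> / s)"
        using s \<Lambda> by (simp add: real_sqrt_mult real_sqrt_divide field_simps)
      thus ?thesis using s unfolding t_def s_def[symmetric] by simp
    qed
    finally show "X \<in> ?good" by (simp add: \<Lambda>_def s_def)
  qed
  hence "measure_pmf.prob law ?G \<le> measure_pmf.prob law ?good"
    by (intro measure_pmf.finite_measure_mono) auto
  moreover have "measure_pmf.prob law ?G \<ge> 1 - \<epsilon>"
    using prob_quadratic_form_bounded_ge[OF T(1), of "t - \<rho>"] tail by linarith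
  ultimately show ?thesis unfolding law_eq by linarith
qed

text \<open>If no admissible \<open>n\<close> were at most \<open>N\<close>, the infimum would be at
  least \<open>N + 1\<close>, also when the set is empty. At \<open>N\<close> itself the condition
  combines with \<open>d_max w \<le> 1\<close> and the positive term \<open>2 * K / N\<close> to
  give the bound on the logarithm.\<close>

lemma N1_gen_threshold:
  assumes w: "graphon w" "K > 0" "lipschitz_A1 w K" and N: "N \<ge> 1" and "rho \<tau> N > 0"
    and thr: "enat N \<ge> N1_gen w K \<tau> e"
  shows "4 * ln (4 * real N / e N) \<le> 9 * (rho \<tau> N * real N)"
proof -
  let ?A = "{n::nat. \<forall>N\<ge>n. d_max w \<ge>
          4 * ln (4 * real N / e N) / (9 * rho \<tau> N * real N) + 2 * K / real N}"
  have "\<exists>n\<in>?A. n \<le> N"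
  proof (rule ccontr)
    assume "\<not> (\<exists>n\<in>?A. n \<le> N)"
    hence "enat (Suc N) \<le> N1_gen w K \<tau> e"
      unfolding N1_gen_def by (intro INF_greatest) force
    with thr show False by (metis Suc_n_not_le_n enat_ord_simps(1) order_trans)
  qed
  hence "4 * ln (4 * real N / e N) / (9 * rho \<tau> N * real N) + 2 * K / real N \<le> d_max w"
    by auto
  also have "\<dots> \<le> 1" by (rule d_max_le_1[OF w])
  finally have "4 * ln (4 * real N / e N) / (9 * rho \<tau> N * real N) \<le> 1"
    using w(2) by (smt (verit) divide_nonneg_nonneg of_nat_0_le_iff)
  thus ?thesis using assms by (simp add: divide_le_eq mult_ac)
qed

lemma rho_range:
  assumes "N \<ge> 1" "0 \<le> \<tau>"
  shows "0 < rho \<tau> N" "rho \<tau> N \<le> 1"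
  using assms powr_mono[of "-\<tau>" 0 "real N"] by (auto simp: rho_def)

theorem mainTheorem8:
  fixes w :: "real \<Rightarrow> real \<Rightarrow> real" and K :: real
  assumes "graphon w" and "K > 0" and "lipschitz_A1 w K"
  shows
    "(\<forall>N::nat. N \<ge> 1 \<longrightarrow>
        op_norm (\<lambda>f x. graphon_laplacian (step_graphon N (sample_matrix w N)) f x
                        - graphon_laplacian w f x)
          \<le> ereal (4 * K / real N))
   \<and> (\<forall>\<tau> \<epsilon> (N::nat). 0 \<le> \<tau> \<and> \<tau> < 1 \<and> 0 < \<epsilon> \<and> \<epsilon> < 1 \<and> N \<ge> 1 \<and> enat N \<ge> N1 w K \<tau> \<epsilon> \<longrightarrow>
        measure_pmf.prob (random_graph w (rho \<tau> N) N)
          {X. op_norm (\<lambda>f x. graphon_laplacian (step_graphon N (adj_matrix X)) f x / rho \<tau> N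
                             - graphon_laplacian w f x)
              \<le> ereal (4 * sqrt (ln (4 * real N / \<epsilon>) / (rho \<tau> N * real N)) + 4 * K / real N)}
        \<ge> 1 - \<epsilon>)
   \<and> (\<forall>\<tau> \<gamma> (N::nat). 0 \<le> \<tau> \<and> \<tau> < 1 \<and> \<gamma> > 1 \<and> N \<ge> 1 \<and> enat N \<ge> N1' w K \<tau> \<gamma> \<longrightarrow>
        measure_pmf.prob (random_graph w (rho \<tau> N) N)
          {X. op_norm (\<lambda>f x. graphon_laplacian (step_graphon N (adj_matrix X)) f x / rho \<tau> N
                             - graphon_laplacian w f x)
              \<le> ereal (4 * sqrt (ln (4 * real N / eps_gamma \<gamma> N) / (rho \<tau> N * real N))
                       + 4 * K / real N)}
        \<ge> 1 - eps_gamma \<gamma> N)"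
proof (intro conjI allI impI)
  fix N :: nat assume "N \<ge> 1"
  thus "op_norm (\<lambda>f x. graphon_laplacian (step_graphon N (sample_matrix w N)) f x
      - graphon_laplacian w f x) \<le> ereal (4 * K / real N)"
    by (rule op_norm_step_laplacian_diff_le[OF assms])
next
  fix \<tau> \<epsilon> and N :: nat
  assume h: "0 \<le> \<tau> \<and> \<tau> < 1 \<and> 0 < \<epsilon> \<and> \<epsilon> < 1 \<and> N \<ge> 1 \<and> enat N \<ge> N1 w K \<tau> \<epsilon>"
  hence "rho \<tau> N > 0" "rho \<tau> N \<le> 1" using rho_range by auto
  with h N1_gen_threshold[OF assms, of N \<tau> "\<lambda>_. \<epsilon>"] show "measure_pmf.prob (random_graph w (rho \<tau> N) N)
      {X. op_norm (\<lambda>f x. graphon_laplacian (step_graphon N (adj_matrix X)) f x / rho \<tau> N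
                         - graphon_laplacian w f x)
          \<le> ereal (4 * sqrt (ln (4 * real N / \<epsilon>) / (rho \<tau> N * real N)) + 4 * K / real N)}
      \<ge> 1 - \<epsilon>"
    by (intro prob_random_laplacian_diff_ge[OF assms]) (auto simp: N1_def)
next
  fix \<tau> \<gamma> and N :: nat
  assume h: "0 \<le> \<tau> \<and> \<tau> < 1 \<and> \<gamma> > 1 \<and> N \<ge> 1 \<and> enat N \<ge> N1' w K \<tau> \<gamma>"
  hence "rho \<tau> N > 0" "rho \<tau> N \<le> 1" using rho_range by auto
  \<comment> \<open>The value 1 is attained at \<open>N = 1\<close>, where the logarithm is 0; the
    probability estimate therefore allows \<open>\<epsilon> = 1\<close>.\<close>
  moreover have "0 < eps_gamma \<gamma> N" "eps_gamma \<gamma> N \<le> 1" by (auto simp: eps_gamma_def)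
  ultimately show "measure_pmf.prob (random_graph w (rho \<tau> N) N)
      {X. op_norm (\<lambda>f x. graphon_laplacian (step_graphon N (adj_matrix X)) f x / rho \<tau> N
                         - graphon_laplacian w f x)
          \<le> ereal (4 * sqrt (ln (4 * real N / eps_gamma \<gamma> N) / (rho \<tau> N * real N))
                   + 4 * K / real N)}
      \<ge> 1 - eps_gamma \<gamma> N"
    using h N1_gen_threshold[OF assms, of N \<tau> "eps_gamma \<gamma>"]
    by (intro prob_random_laplacian_diff_ge[OF assms]) (auto simp: N1'_def)
qed

end
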